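(* Let $\mathcal{F}\subset\mathrm{Hom}(\mathbb{S}^1)$ be such that the semigroup $G_{\mathcal{F}}$ generated by $\mathcal{F}$ has no finite orbit. Let $K_1,\ldots,K_d$ be the $\mathcal{F}$-invariant minimal sets, and assume that $d\geq 2$. Then there exist subsets $L_1,\ldots,L_d$ of $\mathbb{S}^1$ such that, for all $i\in\{1,\ldots,d\}$: (1) $L_i$ is a finite union of closed intervals with extremities in $K_i$; (2) $L_i$ is $\mathcal{F}$-invariant and contains $K_i$; (3) the action of $G_{\mathcal{F}}$ on each connected component $I$ of $L_i$ is proximal; and (4) the sets $L_1,\ldots,L_d$ are pairwise disjoint. Moreover, if $\mathcal{F}\subset\mathrm{Hom}^+(\mathbb{S}^1)$, the sets $L_1,\ldots,L_d$ all have the same number of connected components.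
   Context: $\mathrm{Hom}(\mathbb{S}^1)$ is the group of homeomorphisms of the circle $\mathbb{S}^1$ and $\mathrm{Hom}^+(\mathbb{S}^1)$ the subgroup of orientation-preserving ones. $G_{\mathcal{F}}$ is the smallest semigroup (under composition) of $\mathrm{Hom}(\mathbb{S}^1)$ containing $\mathcal{F}$. "$G_{\mathcal{F}}$ has no finite orbit" means that for every $x\in\mathbb{S}^1$ the set $\mathcal{O}_{\mathcal{F}}(x)=\{f(x): f\in G_{\mathcal{F}}\}$ is infinite. A nonempty set $K\subset\mathbb{S}^1$ is $\mathcal{F}$-invariant if $f(K)\subset K$ for all $f\in\mathcal{F}$. A nonempty closed set $K$ is $\mathcal{F}$-invariant minimal if it is $\mathcal{F}$-invariant and no nonempty closed proper subset of $K$ is $\mathcal{F}$-invariant. It is known (Malicet, 2017) that when $G_{\mathcal{F}}$ has no finite orbit there are only finitely many $\mathcal{F}$-invariant minimal sets; $d$ is their number. For $a\neq b$ in $\mathbb{S}^1$, $[a,b]$ is the closed arc from $a$ to $b$ traversed counterclockwise, and $[a,a]=\{a\}$; these are the closed intervals, and $a,b$ are the extremities of $[a,b]$. $G_{\mathcal{F}}$ acts proximally on an interval $I$ if for all $x,y\in I$ there is a sequence $(g_n)_{n\in\mathbb{N}}$ in $G_{\mathcal{F}}$ with $\lim_{n\to\infty}\mathrm{dist}(g_n(x),g_n(y))=0$. *)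

theory Defs
  imports "HOL-Analysis.Analysis"
begin

abbreviation circle :: "complex set" where
  "circle \<equiv> sphere 0 1"

text \<open>A circle homeomorphism is represented by any map of the plane that restricts to a
  homeomorphism of the unit circle; its values off the circle never matter below.\<close>

definition circle_Hom :: "(complex \<Rightarrow> complex) set" where
  "circle_Hom = {f. \<exists>g. homeomorphism circle circle f g}"

text \<open>Orientation is expressed through lifts along the universal covering
  \<open>cis :: real \<Rightarrow> complex\<close>: preserving it means having an increasing lift.\<close>

definition circle_Hom_plus :: "(complex \<Rightarrow> complex) set" where
  "circle_Hom_plus = {f \<in> circle_Hom.
     \<exists>\<phi> :: real \<Rightarrow> real. continuous_on UNIV \<phi> \<and> strict_mono \<phi> \<and> (\<forall>t. f (cis t) = cis (\<phi> t))}"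

text \<open>The identity belongs to the generated semigroup only if it is a composition of one or
  more generators.\<close>

inductive_set generated_semigroup :: "('a \<Rightarrow> 'a) set \<Rightarrow> ('a \<Rightarrow> 'a) set"
  for F :: "('a \<Rightarrow> 'a) set" where
  generator: "f \<in> F \<Longrightarrow> f \<in> generated_semigroup F"
| comp: "f \<in> generated_semigroup F \<Longrightarrow> g \<in> generated_semigroup F \<Longrightarrow> f \<circ> g \<in> generated_semigroup F"

definition orbit :: "(complex \<Rightarrow> complex) set \<Rightarrow> complex \<Rightarrow> complex set" where
  "orbit F x = {f x | f. f \<in> generated_semigroup F}"

definition no_finite_orbit :: "(complex \<Rightarrow> complex) set \<Rightarrow> bool" where
  "no_finite_orbit F \<longleftrightarrow> (\<forall>x\<in>circle. infinite (orbit F x))"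

definition invariant_set :: "(complex \<Rightarrow> complex) set \<Rightarrow> complex set \<Rightarrow> bool" where
  "invariant_set F K \<longleftrightarrow> K \<noteq> {} \<and> K \<subseteq> circle \<and> (\<forall>f\<in>F. f ` K \<subseteq> K)"

text \<open>As the circle is closed in the plane, its relatively closed subsets are exactly those
  closed in the plane.\<close>

definition invariant_minimal :: "(complex \<Rightarrow> complex) set \<Rightarrow> complex set \<Rightarrow> bool" where
  "invariant_minimal F K \<longleftrightarrow> closed K \<and> invariant_set F K \<and>
     \<not> (\<exists>K'. closed K' \<and> invariant_set F K' \<and> K' \<subset> K)"

text \<open>For \<open>a\<close>, \<open>b\<close> on the circle, \<open>Arg2pi (b / a) \<in> {0..<2 * pi}\<close> is the counterclockwise angle
  from \<open>a\<close> to \<open>b\<close>; in particular the arc from \<open>a\<close> to \<open>a\<close> is the single point \<open>a\<close>.\<close>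

definition circle_interval :: "complex \<Rightarrow> complex \<Rightarrow> complex set" where
  "circle_interval a b = {a * cis t | t. 0 \<le> t \<and> t \<le> Arg2pi (b / a)}"

definition finite_union_of_intervals :: "complex set \<Rightarrow> complex set \<Rightarrow> bool" where
  "finite_union_of_intervals K L \<longleftrightarrow>
     (\<exists>P. finite P \<and> P \<subseteq> K \<times> K \<and> L = (\<Union>(a, b)\<in>P. circle_interval a b))"

definition acts_proximally :: "(complex \<Rightarrow> complex) set \<Rightarrow> complex set \<Rightarrow> bool" where
  "acts_proximally F I \<longleftrightarrow> (\<forall>x\<in>I. \<forall>y\<in>I. \<exists>g :: nat \<Rightarrow> complex \<Rightarrow> complex.
     (\<forall>n. g n \<in> generated_semigroup F) \<and> (\<lambda>n. dist (g n x) (g n y)) \<longlonglongrightarrow> 0)"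

lemma circle_interval_refl: "a \<in> circle \<Longrightarrow> circle_interval a a = {a}"
  by (force simp: circle_interval_def Arg2pi_of_real[of 1, simplified])

lemma circle_interval_endpoints:
  assumes "a \<in> circle" "b \<in> circle"
  shows "a \<in> circle_interval a b" "b \<in> circle_interval a b" "circle_interval a b \<subseteq> circle"
proof -
  have a: "a \<noteq> 0" "norm (b / a) = 1"
    using assms by (auto simp: norm_divide)
  then have "b / a = cis (Arg2pi (b / a))"
    using Arg2pi_eq[of "b / a"] by (simp add: cis_conv_exp mult.commute)
  then have "b = a * cis (Arg2pi (b / a))"
    using a by (simp add: field_simps)
  then show "b \<in> circle_interval a b"
    using Arg2pi_ge_0 by (auto simp: circle_interval_def)
  show "a \<in> circle_interval a b"
    using Arg2pi_ge_0 by (force simp: circle_interval_def intro: exI[of _ 0])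
  show "circle_interval a b \<subseteq> circle"
    using assms by (auto simp: circle_interval_def norm_mult)
qed

end

(* Call a composition positive or negative according as it preserves or reverses the cyclic order.
   Restricted to one minimal set K i, the closures of the orbits under the positive compositions
   partition K i into at most two closed classes, which the negative compositions permute.
   Colour the union X of all K i by these classes and cut X into blocks, the maximal pieces lying on
   an arc that meets only one colour. There are finitely many blocks because classes are at positive
   distance, and since preimages of such arcs are such arcs, every generator pulls blocks back to
   blocks; finiteness turns this into a permutation of the blocks. So the arcs spanned by the
   blocks are mapped into one another, and L i is the union of those spanned by blocks in K i.
   A spanned arc [a, b] is contracted because a is a limit of g b for positive g, and g maps [a, b]
   into [a, g b]. If all generators are positive, they also preserve the number of blocks met by
   the arc from x to y, which injects the blocks of K i into those of K j. *)

theory Submission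
  imports Defs
begin

section \<open>Arcs and circle homeomorphisms\<close>

text \<open>Two obstacles shape the argument. A generator maps \<open>X\<close> into itself, but not
  necessarily onto itself. The image of an arc with one colour may therefore meet points of
  \<open>X\<close> outside the image of \<open>X\<close>, about whose colours nothing is known
  directly. Preimages have no such defect, which is why linkedness is pulled back and its forward
  transport is left to counting. The minimal sets alone would be too coarse as colours. If a
  reversing \<open>g\<close> brings \<open>g b\<close> close to \<open>a\<close>, the image of
  [a, b] is the arc from \<open>g b\<close> to \<open>g a\<close>, whose far end is uncontrolled.
  With classes of positive compositions as colours, the two ends of one block can be brought
  together by a positive \<open>g\<close>. The assumption \<open>d \<ge> 2\<close> supplies, for
  every colour, a point of another colour. An arc that meets only the former misses that point.
  Cutting the circle there turns cyclic order on the arc into the order of real angles.\<close>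

definition ang :: "complex \<Rightarrow> complex \<Rightarrow> real" where
  "ang a z = Arg2pi (z / a)"

lemma ang_ge_0 [simp]: "0 \<le> ang a z" and ang_less_2pi [simp]: "ang a z < 2 * pi"
  by (simp_all add: ang_def Arg2pi_ge_0 Arg2pi_lt_2pi)

lemma circle_nonzero: "a \<in> circle \<Longrightarrow> a \<noteq> 0"
  by auto

lemma ang_eqI:
  assumes "a \<in> circle" "z = a * cis t" "0 \<le> t" "t < 2 * pi"
  shows "ang a z = t"
  unfolding ang_def
  by (rule Arg2pi_unique[of 1]) (use assms circle_nonzero in \<open>auto simp: cis_conv_exp\<close>)

lemma cis_ang:
  assumes "a \<in> circle" "z \<in> circle"
  shows "a * cis (ang a z) = z"
proof -
  have "norm (z / a) = 1"
    using assms by (simp add: norm_divide)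
  then have "z / a = cis (ang a z)"
    using Arg2pi_eq[of "z / a"] by (simp add: cis_conv_exp mult.commute ang_def)
  then show ?thesis
    using circle_nonzero[OF assms(1)] by (simp add: field_simps)
qed

lemma ang_inject:
  assumes "a \<in> circle" "z \<in> circle" "w \<in> circle"
  shows "ang a z = ang a w \<longleftrightarrow> z = w"
  using assms by (metis cis_ang)

lemma ang_refl [simp]: "a \<in> circle \<Longrightarrow> ang a a = 0"
  by (rule ang_eqI) auto

lemma ang_eq_0_iff: "a \<in> circle \<Longrightarrow> z \<in> circle \<Longrightarrow> ang a z = 0 \<longleftrightarrow> z = a"
  using ang_inject[of a z a] by simp

lemma ang_pos: "a \<in> circle \<Longrightarrow> z \<in> circle \<Longrightarrow> z \<noteq> a \<Longrightarrow> 0 < ang a z"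
  using ang_ge_0[of a z] ang_eq_0_iff[of a z] by (simp only: less_le) metis

lemma mult_cis_in_circle: "a \<in> circle \<Longrightarrow> a * cis t \<in> circle"
  by (simp add: norm_mult)

text \<open>Change of base point: the difference of angles is corrected by a full turn exactly when
  \<open>z\<close> precedes \<open>a\<close> as seen from \<open>p\<close>.\<close>

lemma ang_shift:
  assumes "p \<in> circle" "a \<in> circle" "z \<in> circle"
  shows "ang a z = (if ang p a \<le> ang p z then ang p z - ang p a else ang p z - ang p a + 2 * pi)"
proof (rule ang_eqI[OF assms(2)])
  have "a * cis (ang p z - ang p a) = p * cis (ang p z)"
    by (subst cis_ang[OF assms(1,2), symmetric]) (simp add: mult.assoc cis_mult)
  then have *: "a * cis (ang p z - ang p a) = z"
    using cis_ang assms by simp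
  then show "z = a * cis (if ang p a \<le> ang p z then ang p z - ang p a else ang p z - ang p a + 2 * pi)"
    using cis_mult[of "ang p z - ang p a" "2 * pi"] by simp
  show "(if ang p a \<le> ang p z then ang p z - ang p a else ang p z - ang p a + 2 * pi) < 2 * pi"
    using ang_less_2pi[of p z] ang_ge_0[of p a] by (auto simp: not_le simp del: ang_less_2pi ang_ge_0)
qed (use ang_less_2pi[of p a] ang_ge_0[of p z] in \<open>auto simp: not_le simp del: ang_less_2pi ang_ge_0\<close>)

lemma circle_interval_iff:
  assumes "a \<in> circle" "b \<in> circle"
  shows "z \<in> circle_interval a b \<longleftrightarrow> z \<in> circle \<and> ang a z \<le> ang a b"
proof
  assume "z \<in> circle_interval a b"
  then obtain t where t: "z = a * cis t" "0 \<le> t" "t \<le> ang a b"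
    by (auto simp: circle_interval_def ang_def)
  moreover have "ang a z = t"
    using t ang_less_2pi[of a b] by (intro ang_eqI assms) linarith+
  ultimately show "z \<in> circle \<and> ang a z \<le> ang a b"
    using assms mult_cis_in_circle by simp
next
  assume "z \<in> circle \<and> ang a z \<le> ang a b"
  then show "z \<in> circle_interval a b"
    using cis_ang[OF assms(1), of z] ang_ge_0[of a z]
    by (auto simp: circle_interval_def ang_def simp del: ang_ge_0 intro!: exI[of _ "Arg2pi (z / a)"])
qed

text \<open>Seen from one base point, membership in an arc is a comparison of three reals, so
  questions of cyclic order reduce to linear arithmetic. The second case is that of an arc running
  across the cut at \<open>p\<close>.\<close>

lemma circle_interval_base:
  assumes "p \<in> circle" "a \<in> circle" "b \<in> circle" "z \<in> circle"
  shows "z \<in> circle_interval a b \<longleftrightarrow>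
    (if ang p a \<le> ang p b then ang p a \<le> ang p z \<and> ang p z \<le> ang p b
     else ang p a \<le> ang p z \<or> ang p z \<le> ang p b)"
  using assms ang_shift[of p a z] ang_shift[of p a b] ang_less_2pi[of p z] ang_less_2pi[of p b]
    ang_ge_0[of p z] ang_ge_0[of p b]
  by (auto simp: circle_interval_iff simp del: ang_less_2pi ang_ge_0)

lemma circle_interval_Un:
  assumes "a \<in> circle" "b \<in> circle" "a \<noteq> b"
  shows "circle_interval a b \<union> circle_interval b a = circle"
    and "circle_interval a b \<inter> circle_interval b a = {a, b}"
proof -
  have "ang a b > 0"
    using assms ang_ge_0[of a b] ang_eq_0_iff[of a b] by (auto simp: less_le simp del: ang_ge_0)
  then have "z \<in> circle_interval b a \<longleftrightarrow> z \<in> circle \<and> (ang a b \<le> ang a z \<or> z = a)" for z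
    using assms circle_interval_base[of a b a z] circle_interval_iff[of b a z]
      ang_ge_0[of a z] ang_eq_0_iff[of a z] by (auto simp del: ang_ge_0)
  moreover have "z \<in> circle_interval a b \<longleftrightarrow> z \<in> circle \<and> ang a z \<le> ang a b" for z
    using assms circle_interval_iff by blast
  ultimately show "circle_interval a b \<union> circle_interval b a = circle"
    "circle_interval a b \<inter> circle_interval b a = {a, b}"
    using assms ang_inject[of a _ b] by (auto simp: set_eq_iff)
qed

text \<open>Both sides say that \<open>x\<close>, \<open>z\<close>, \<open>y\<close> occur in this
  counterclockwise order, read off from different starting points. Degenerate arcs break the
  symmetry, hence the two inequalities.\<close>

lemma circle_interval_rotate:
  assumes "x \<in> circle" "y \<in> circle" "z \<in> circle" "x \<noteq> y" "x \<noteq> z"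
  shows "z \<in> circle_interval x y \<longleftrightarrow> y \<in> circle_interval z x"
proof -
  have "ang x z > 0"
    using assms ang_ge_0[of x z] ang_eq_0_iff[of x z] by (auto simp: less_le simp del: ang_ge_0)
  moreover have "ang x y > 0"
    using assms ang_ge_0[of x y] ang_eq_0_iff[of x y] by (auto simp: less_le simp del: ang_ge_0)
  ultimately show ?thesis
    using assms circle_interval_base[of x z x y] circle_interval_iff[of x y z] by (auto simp del: mem_sphere)
qed

lemma circle_interval_eq_image:
  "circle_interval a b = (\<lambda>t. a * cis t) ` {0..ang a b}"
  by (auto simp: circle_interval_def ang_def)

lemma connected_circle_interval: "connected (circle_interval a b)"
  unfolding circle_interval_eq_image
  by (intro connected_continuous_image continuous_intros) auto

lemma compact_circle_interval: "compact (circle_interval a b)"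
  unfolding circle_interval_eq_image
  by (intro compact_continuous_image continuous_intros) auto

text \<open>The arcs [a, b] and [b, a] are closed, cover the circle and share only their ends, so a
  connected set avoiding both ends lies in one of them. This is how a connected witness is compared
  with an arc throughout.\<close>

lemma connected_crosses_circle_interval:
  assumes "connected C" "C \<subseteq> circle" "a \<in> circle" "b \<in> circle"
    and "z \<in> C" "z \<in> circle_interval a b" "w \<in> C" "w \<notin> circle_interval a b"
  shows "a \<in> C \<or> b \<in> C"
proof (cases "a = b")
  case True
  then show ?thesis
    using assms circle_interval_refl by force
next
  case False
  show ?thesis
  proof (rule ccontr)
    assume "\<not> (a \<in> C \<or> b \<in> C)"
    then have "circle_interval a b \<inter> circle_interval b a \<inter> C = {}"
      "C \<subseteq> circle_interval a b \<union> circle_interval b a"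
      using circle_interval_Un[OF assms(3,4) False] assms(2) by auto
    moreover have "closed (circle_interval a b)" "closed (circle_interval b a)"
      by (auto intro: compact_imp_closed compact_circle_interval)
    moreover have "w \<in> circle_interval b a"
      using circle_interval_Un(1)[OF assms(3,4) False] assms(2,7,8) by auto
    ultimately show False
      using assms(1,5-8) unfolding connected_closed by blast
  qed
qed

lemma continuous_on_ang:
  assumes "p \<in> circle"
  shows "continuous_on (circle - {p}) (ang p)"
  unfolding continuous_on_eq_continuous_within
proof
  fix z assume z: "z \<in> circle - {p}"
  have "z / p \<notin> \<real>\<^sub>\<ge>\<^sub>0"
  proof
    assume "z / p \<in> \<real>\<^sub>\<ge>\<^sub>0"
    then have "Arg2pi (z / p) = 0"
      by (simp add: Arg2pi_eq_0 complex_nonneg_Reals_iff complex_is_Real_iff)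
    then show False
      using z assms ang_eq_0_iff[of p z] by (simp add: ang_def)
  qed
  then have "isCont (\<lambda>z. Arg2pi (z / p)) z"
    using assms by (intro isCont_o2[where g = Arg2pi and f = "\<lambda>z. z / p"] continuous_at_Arg2pi)
      (auto intro!: continuous_intros)
  then show "continuous (at z within circle - {p}) (ang p)"
    unfolding ang_def by (rule continuous_at_imp_continuous_at_within)
qed

lemma dist_circle_le_ang:
  assumes "p \<in> circle" "z \<in> circle" "w \<in> circle"
  shows "dist z w \<le> \<bar>ang p z - ang p w\<bar>"
proof -
  have "z - w = p * (cis (ang p z) - cis (ang p w))"
    using assms by (simp add: algebra_simps cis_ang)
  then have "dist z w = norm (cis (ang p z) - cis (ang p w))"
    using assms by (simp add: dist_norm norm_mult)
  also have "cis (ang p z) - cis (ang p w) = cis (ang p w) * (cis (ang p z - ang p w) - 1)"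
    by (simp add: algebra_simps cis_mult)
  also have "norm \<dots> = norm (exp (\<i> * of_real (ang p z - ang p w)) - 1)"
    by (simp add: norm_mult cis_conv_exp)
  also have "\<dots> \<le> \<bar>ang p z - ang p w\<bar>"
    using abs_sin_x_le_abs_x[of "(ang p z - ang p w) / 2"] by (simp only: dist_exp_i_1) simp
  finally show ?thesis .
qed

section \<open>Homeomorphisms and cyclic order\<close>

definition preserves_arcs :: "(complex \<Rightarrow> complex) \<Rightarrow> bool" where
  "preserves_arcs f \<longleftrightarrow> (\<forall>a\<in>circle. \<forall>b\<in>circle. \<forall>z\<in>circle.
     f z \<in> circle_interval (f a) (f b) \<longleftrightarrow> z \<in> circle_interval a b)"

definition reverses_arcs :: "(complex \<Rightarrow> complex) \<Rightarrow> bool" where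
  "reverses_arcs f \<longleftrightarrow> (\<forall>a\<in>circle. \<forall>b\<in>circle. \<forall>z\<in>circle.
     f z \<in> circle_interval (f b) (f a) \<longleftrightarrow> z \<in> circle_interval a b)"

lemma circle_HomD:
  assumes "f \<in> circle_Hom"
  shows "continuous_on circle f" "f ` circle = circle" "inj_on f circle" "z \<in> circle \<Longrightarrow> f z \<in> circle"
  using assms by (auto simp: circle_Hom_def homeomorphism_def intro: inj_on_inverseI)

lemma preserves_arcsI:
  assumes "p \<in> circle" "\<And>z. z \<in> circle \<Longrightarrow> f z \<in> circle"
    and "\<And>z w. z \<in> circle \<Longrightarrow> w \<in> circle \<Longrightarrow> ang (f p) (f z) \<le> ang (f p) (f w) \<longleftrightarrow> ang p z \<le> ang p w"
  shows "preserves_arcs f"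
  unfolding preserves_arcs_def
proof (intro ballI)
  fix a b z assume abz: "a \<in> circle" "b \<in> circle" "z \<in> circle"
  show "f z \<in> circle_interval (f a) (f b) \<longleftrightarrow> z \<in> circle_interval a b"
    using circle_interval_base[OF assms(1) abz]
      circle_interval_base[OF assms(2)[OF assms(1)] assms(2)[OF abz(1)] assms(2)[OF abz(2)] assms(2)[OF abz(3)]]
    by (simp only: assms(3) abz)
qed

text \<open>The base point has to be left out of the order condition: its own angle is 0, the least
  value, both before and after applying \<open>f\<close>, so it does not take part in the
  reversal.\<close>

lemma reverses_arcsI:
  assumes p: "p \<in> circle" and f: "f \<in> circle_Hom"
    and ord: "\<And>z w. z \<in> circle - {p} \<Longrightarrow> w \<in> circle - {p} \<Longrightarrow>
       ang (f p) (f z) \<le> ang (f p) (f w) \<longleftrightarrow> ang p w \<le> ang p z"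
  shows "reverses_arcs f"
  unfolding reverses_arcs_def
proof (intro ballI)
  note fc = circle_HomD(4)[OF f]
  fix a b z assume abz: "a \<in> circle" "b \<in> circle" "z \<in> circle"
  note fa = fc[OF abz(1)] and fb = fc[OF abz(2)] and fz = fc[OF abz(3)] and fp = fc[OF p]
  have pos: "ang p x > 0" "ang (f p) (f x) > 0" if "x \<in> circle" "x \<noteq> p" for x
  proof -
    have "f x \<noteq> f p"
      using inj_on_eq_iff[OF circle_HomD(3)[OF f] that(1) p] that(2) by simp
    then show "ang p x > 0" "ang (f p) (f x) > 0"
      using ang_pos[OF p] ang_pos[OF fp] fc that by blast+
  qed
  have zero: "ang p p = 0" "ang (f p) (f p) = 0"
    using p fp by simp_all
  have ord': "ang (f p) (f x) \<le> ang (f p) (f y) \<longleftrightarrow> x = p \<or> y \<noteq> p \<and> ang p y \<le> ang p x"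
    "ang p x \<le> ang p y \<longleftrightarrow> x = p \<or> y \<noteq> p \<and> ang p x \<le> ang p y"
    if "x \<in> circle" "y \<in> circle" for x y
    using ord[of x y] that pos[of x] pos[of y] zero
    by (cases "x = p"; cases "y = p"; simp)+
  show "f z \<in> circle_interval (f b) (f a) \<longleftrightarrow> z \<in> circle_interval a b"
    unfolding circle_interval_base[OF p abz] circle_interval_base[OF fp fb fa fz]
    using ord'(1)[OF abz(1,2)] ord'(1)[OF abz(2,1)] ord'(1)[OF abz(1,3)] ord'(1)[OF abz(3,1)]
      ord'(1)[OF abz(2,3)] ord'(1)[OF abz(3,2)] ord'(2)[OF abz(1,2)] ord'(2)[OF abz(1,3)]
      ord'(2)[OF abz(2,3)] ord'(2)[OF abz(3,1)] ord'(2)[OF abz(3,2)]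
    by (smt (verit))
qed

text \<open>Cutting the source at \<open>p\<close> and the target at \<open>f p\<close> turns
  \<open>f\<close> into a continuous injective function \<open>h\<close> on an open interval, which
  is therefore strictly monotone. The cut itself is treated apart, because \<open>h 0 = 0\<close>
  whichever way \<open>h\<close> runs.\<close>

lemma circle_Hom_preserves_or_reverses_arcs:
  assumes f: "f \<in> circle_Hom"
  shows "preserves_arcs f \<or> reverses_arcs f"
proof -
  note fD = circle_HomD[OF f]
  define p :: complex where "p = 1"
  have p: "p \<in> circle"
    by (simp add: p_def)
  define h where "h = (\<lambda>t. ang (f p) (f (p * cis t)))"
  have arg: "p * cis t \<in> circle - {p}" if "t \<in> {0<..<2 * pi}" for t
    using that p ang_eqI[OF p refl, of t] mult_cis_in_circle by fastforce
  have mem: "f (p * cis t) \<in> circle - {f p}" if "t \<in> {0<..<2 * pi}" for t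
    using arg[OF that] fD(4) p inj_on_eq_iff[OF fD(3)] by blast
  have "continuous_on {0<..<2 * pi} (\<lambda>t. f (p * cis t))"
    by (intro continuous_on_compose2[OF fD(1)] continuous_intros) (use arg in blast)
  then have "continuous_on {0<..<2 * pi} h"
    unfolding h_def using mem p fD(4)
    by (intro continuous_on_compose2[OF continuous_on_ang]) auto
  moreover have "inj_on h {0<..<2 * pi}"
  proof
    fix s t assume st: "s \<in> {0<..<2 * pi}" "t \<in> {0<..<2 * pi}" "h s = h t"
    then have "f (p * cis s) = f (p * cis t)"
      using ang_inject[of "f p"] mem fD(4) p unfolding h_def by auto
    then have "p * cis s = p * cis t"
      using inj_on_eq_iff[OF fD(3)] arg st by simp
    then have "ang p (p * cis s) = ang p (p * cis t)"
      by (rule arg_cong)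
    moreover have "ang p (p * cis s) = s" "ang p (p * cis t) = t"
      using st by (intro ang_eqI[OF p refl]; simp)+
    ultimately show "s = t"
      by metis
  qed
  ultimately have mono: "strict_mono_on {0<..<2 * pi} h \<or> strict_antimono_on {0<..<2 * pi} h"
    using injective_eq_monotone_map[of "{0<..<2 * pi}" h] is_interval_oo by blast
  have h: "ang (f p) (f z) = h (ang p z)" if "z \<in> circle" for z
    using that p by (simp add: h_def cis_ang)
  have pos: "ang p z \<in> {0<..<2 * pi}" if "z \<in> circle - {p}" for z
    using that ang_pos[OF p, of z] by simp
  have h0: "h 0 = 0"
    using p fD(4) by (simp add: h_def)
  have h_pos: "h t > 0" if "t \<in> {0<..<2 * pi}" for t
    using mem[OF that] ang_pos[OF fD(4)[OF p]] by (simp add: h_def)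
  from mono show ?thesis
  proof
    assume inc: "strict_mono_on {0<..<2 * pi} h"
    have "preserves_arcs f"
    proof (rule preserves_arcsI[OF p fD(4)])
      fix z w assume zw: "z \<in> circle" "w \<in> circle"
      have "h (ang p z) \<le> h (ang p w) \<longleftrightarrow> ang p z \<le> ang p w"
      proof -
        consider "z = p" | "w = p" "z \<noteq> p" | "z \<in> circle - {p}" "w \<in> circle - {p}"
          using zw by blast
        then show ?thesis
        proof cases
          case 1
          then show ?thesis
            using p h0 h_pos[OF pos, of w] zw(2) by (cases "w = p") (simp_all add: less_imp_le)
        next
          case 2
          then show ?thesis
            using p h0 h_pos[OF pos, of z] pos[of z] zw(1) by simp
        next
          case 3
          then show ?thesis
            using strict_mono_on_less_eq[OF inc] pos by blast
        qed
      qed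
      then show "ang (f p) (f z) \<le> ang (f p) (f w) \<longleftrightarrow> ang p z \<le> ang p w"
        by (simp only: h zw)
    qed
    then show ?thesis ..
  next
    assume dec: "strict_antimono_on {0<..<2 * pi} h"
    have "reverses_arcs f"
    proof (rule reverses_arcsI[OF p f])
      fix z w assume zw: "z \<in> circle - {p}" "w \<in> circle - {p}"
      have "h (ang p z) \<le> h (ang p w) \<longleftrightarrow> ang p w \<le> ang p z"
        using monotone_onD[OF dec pos[OF zw(1)] pos[OF zw(2)]]
          monotone_onD[OF dec pos[OF zw(2)] pos[OF zw(1)]] by fastforce
      then show "ang (f p) (f z) \<le> ang (f p) (f w) \<longleftrightarrow> ang p w \<le> ang p z"
        using zw by (simp only: h DiffD1)
    qed
    then show ?thesis ..
  qed
qed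

lemma circle_Hom_plus_preserves_arcs:
  assumes f: "f \<in> circle_Hom_plus"
  shows "preserves_arcs f"
proof -
  obtain \<phi> :: "real \<Rightarrow> real" where \<phi>: "continuous_on UNIV \<phi>" "strict_mono \<phi>" "\<And>t. f (cis t) = cis (\<phi> t)"
    using f by (auto simp: circle_Hom_plus_def)
  have fD: "inj_on f circle" "\<And>z. z \<in> circle \<Longrightarrow> f z \<in> circle"
    using f circle_HomD by (auto simp: circle_Hom_plus_def)
  have one: "1 \<in> circle"
    by simp
  \<comment> \<open>A lift gaining a full turn before its argument does would, by the intermediate
    value theorem, give two points of the circle the same image. Hence increments of the lift from 0
    are genuine angles.\<close>
  have short: "\<phi> t - \<phi> 0 < 2 * pi" if t: "0 \<le> t" "t < 2 * pi" for t
  proof (rule ccontr)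
    assume "\<not> \<phi> t - \<phi> 0 < 2 * pi"
    then obtain s where s: "0 \<le> s" "s \<le> t" "\<phi> s = \<phi> 0 + 2 * pi"
      using IVT'[of \<phi> 0 "\<phi> 0 + 2 * pi" t] t \<phi>(1) continuous_on_subset by fastforce
    then have "f (cis s) = f (cis 0)"
      using cis_mult[of "\<phi> 0" "2 * pi"] by (simp only: \<phi>(3)) simp
    then have "cis s = cis 0"
      using inj_onD[OF fD(1)] by simp
    then have "s = 0"
      using ang_eqI[OF one, of "cis s" s] ang_refl[OF one] s t by simp
    then show False
      using s by simp
  qed
  have "ang (f 1) (f z) = \<phi> (ang 1 z) - \<phi> 0" if "z \<in> circle" for z
  proof (rule ang_eqI)
    have "f z = cis (\<phi> (ang 1 z))" "f 1 = cis (\<phi> 0)"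
      using \<phi>(3)[of "ang 1 z"] \<phi>(3)[of 0] cis_ang[OF one that] by simp_all
    then show "f z = f 1 * cis (\<phi> (ang 1 z) - \<phi> 0)"
      by (simp add: cis_mult)
    show "0 \<le> \<phi> (ang 1 z) - \<phi> 0"
      using strict_mono_less_eq[OF \<phi>(2)] by simp
  qed (use short fD(2) one in auto)
  then show ?thesis
    using strict_mono_less_eq[OF \<phi>(2)] fD(2) by (intro preserves_arcsI[OF one]) auto
qed

lemma image_circle_interval:
  assumes "f \<in> circle_Hom" "a \<in> circle" "b \<in> circle"
  shows "preserves_arcs f \<Longrightarrow> f ` circle_interval a b = circle_interval (f a) (f b)"
    and "reverses_arcs f \<Longrightarrow> f ` circle_interval a b = circle_interval (f b) (f a)"
proof -
  have sub: "circle_interval x y \<subseteq> circle" if "x \<in> circle" "y \<in> circle" for x y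
    using circle_interval_endpoints(3)[OF that] .
  note fD = circle_HomD[OF assms(1)]
  have "f ` circle_interval a b = I"
    if I: "\<And>z. z \<in> circle \<Longrightarrow> f z \<in> I \<longleftrightarrow> z \<in> circle_interval a b" "I \<subseteq> circle" for I
  proof (intro equalityI subsetI)
    fix w assume "w \<in> I"
    moreover from this obtain z where "z \<in> circle" "w = f z"
      using I(2) fD(2) by blast
    ultimately show "w \<in> f ` circle_interval a b"
      using I by blast
  qed (use I sub assms in blast)
  then show "preserves_arcs f \<Longrightarrow> f ` circle_interval a b = circle_interval (f a) (f b)"
    "reverses_arcs f \<Longrightarrow> f ` circle_interval a b = circle_interval (f b) (f a)"
    using assms sub fD(4) by (simp_all add: preserves_arcs_def reverses_arcs_def)
qed

section \<open>Blocks of a coloured closed subset of the circle\<close>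

text \<open>By finiteness the union of the other members is closed, so a connected set that includes
  one member cannot reach any other.\<close>

lemma components_Union_disjoint_closed:
  assumes "finite \<A>" "pairwise disjnt \<A>"
    and "\<And>A. A \<in> \<A> \<Longrightarrow> closed A \<and> connected A \<and> A \<noteq> {}"
  shows "components (\<Union>\<A>) = \<A>"
proof -
  have sub: "A \<in> components (\<Union>\<A>)" if A: "A \<in> \<A>" for A
    unfolding in_components_maximal
  proof (intro conjI allI impI)
    fix D assume D: "D \<noteq> {} \<and> A \<subseteq> D \<and> D \<subseteq> \<Union>\<A> \<and> connected D"
    have "closed (\<Union>(\<A> - {A}))"
      using assms by (intro closed_Union) auto
    moreover have "A \<inter> \<Union>(\<A> - {A}) = {}"
      using assms(2) A unfolding pairwise_def disjnt_def by blast
    moreover have "D \<subseteq> A \<union> \<Union>(\<A> - {A})"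
      using D by blast
    moreover have "A \<inter> D \<noteq> {}"
      using D assms(3)[OF A] by blast
    ultimately have "\<Union>(\<A> - {A}) \<inter> D = {}"
      using connected_closedD[of D A "\<Union>(\<A> - {A})"] D assms(3)[OF A] by blast
    then show "D = A"
      using D by blast
  qed (use assms(3)[OF A] A in auto)
  moreover have "C \<in> \<A>" if C: "C \<in> components (\<Union>\<A>)" for C
  proof -
    obtain x A where "x \<in> C" "A \<in> \<A>" "x \<in> A"
      using in_components_nonempty[OF C] in_components_subset[OF C] by blast
    then have "C = A"
      using components_eq[OF C sub] by blast
    then show ?thesis
      using \<open>A \<in> \<A>\<close> by simp
  qed
  ultimately show ?thesis
    by blast
qed

text \<open>Closedness and finiteness keep each colour away from the union of the others;
  \<open>other_colour\<close> rules out that the whole circle counts as a one-colour set. Colours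
  are only ever compared for equality, so their type is left open.\<close>

locale coloured_set =
  fixes X :: "complex set" and c :: "complex \<Rightarrow> 'c"
  assumes X_circle: "X \<subseteq> circle"
    and closed_colour: "\<And>v. closed {x \<in> X. c x = v}"
    and finite_colours: "finite (c ` X)"
    and other_colour: "\<And>v. \<exists>p\<in>X. c p \<noteq> v"
begin

definition monochrome :: "complex set \<Rightarrow> bool" where
  "monochrome C \<longleftrightarrow> (\<forall>u\<in>C \<inter> X. \<forall>v\<in>C \<inter> X. c u = c v)"

lemma monochromeD: "monochrome C \<Longrightarrow> u \<in> C \<Longrightarrow> v \<in> C \<Longrightarrow> u \<in> X \<Longrightarrow> v \<in> X \<Longrightarrow> c u = c v"
  unfolding monochrome_def by blast

text \<open>The witness is any connected set rather than an arc. Unions then give transitivity, and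
  preimages under homeomorphisms are again witnesses without distinguishing orientations.\<close>

definition linked :: "complex \<Rightarrow> complex \<Rightarrow> bool" where
  "linked x y \<longleftrightarrow> x \<in> X \<and> y \<in> X \<and>
     (\<exists>C. C \<subseteq> circle \<and> connected C \<and> x \<in> C \<and> y \<in> C \<and> monochrome C)"

definition block :: "complex \<Rightarrow> complex set" where
  "block x = {y. linked x y}"

lemma linkedI: "x \<in> X \<Longrightarrow> y \<in> X \<Longrightarrow> C \<subseteq> circle \<Longrightarrow> connected C \<Longrightarrow> x \<in> C \<Longrightarrow> y \<in> C \<Longrightarrow>
    monochrome C \<Longrightarrow> linked x y"
  unfolding linked_def by blast

lemma linked_in: "linked x y \<Longrightarrow> x \<in> X" "linked x y \<Longrightarrow> y \<in> X"
  by (auto simp: linked_def)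

lemma linked_colour: "linked x y \<Longrightarrow> c x = c y"
  unfolding linked_def monochrome_def by blast

lemma linked_refl: "x \<in> X \<Longrightarrow> linked x x"
  by (rule linkedI[of _ _ "{x}"]) (use X_circle in \<open>auto simp: monochrome_def\<close>)

lemma linked_sym: "linked x y \<Longrightarrow> linked y x"
  unfolding linked_def by blast

lemma linked_trans:
  assumes "linked x y" "linked y z"
  shows "linked x z"
proof -
  obtain C D where CD: "C \<subseteq> circle" "connected C" "x \<in> C" "y \<in> C" "monochrome C"
    "D \<subseteq> circle" "connected D" "y \<in> D" "z \<in> D" "monochrome D"
    using assms unfolding linked_def by blast
  have "c u = c y" if "u \<in> (C \<union> D) \<inter> X" for u
    using that CD(4,5,8,10) linked_in(2)[OF assms(1)] unfolding monochrome_def by blast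
  then have "monochrome (C \<union> D)"
    unfolding monochrome_def by metis
  moreover have "connected (C \<union> D)"
    using CD by (intro connected_Un) auto
  ultimately show ?thesis
    using linked_in assms CD by (intro linkedI[of _ _ "C \<union> D"]) auto
qed

lemma block_eq_iff: "x \<in> X \<Longrightarrow> block x = block y \<longleftrightarrow> linked x y"
  unfolding block_def using linked_refl linked_sym linked_trans by blast

lemma block_subset: "block x \<subseteq> X"
  using linked_in by (auto simp: block_def)

lemma self_in_block: "x \<in> X \<Longrightarrow> x \<in> block x"
  by (simp add: block_def linked_refl)

lemma block_cases: "B \<in> block ` X \<Longrightarrow> x \<in> B \<Longrightarrow> x \<in> X \<and> B = block x"
  using block_eq_iff linked_in linked_sym by (auto simp: block_def)

lemma closed_X: "closed X"
proof -
  have "X = (\<Union>v\<in>c ` X. {x \<in> X. c x = v})"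
    by blast
  then show ?thesis
    using closed_UN[OF finite_colours, of "\<lambda>v. {x \<in> X. c x = v}"] closed_colour by simp
qed

text \<open>The union of the other colours is closed, and the circle is locally connected, so
  \<open>x\<close> has a connected neighbourhood free of other colours. Blocks are thus relatively
  open in \<open>X\<close>; their finiteness and compactness both rest on this.\<close>

lemma linked_near:
  assumes x: "x \<in> X"
  obtains e where "e > 0" "\<And>y. y \<in> X \<Longrightarrow> dist x y < e \<Longrightarrow> linked x y"
proof -
  define D where "D = (\<Union>v\<in>c ` X - {c x}. {y \<in> X. c y = v})"
  have "closed D"
    unfolding D_def using finite_colours closed_colour by (intro closed_UN) auto
  then have "openin (top_of_set circle) (circle \<inter> - D)"
    by (auto intro: openin_open_Int)
  moreover have "x \<in> circle \<inter> - D"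
    using x X_circle by (auto simp: D_def)
  ultimately obtain U where U: "openin (top_of_set circle) U" "connected U" "x \<in> U" "U \<subseteq> circle \<inter> - D"
    using locally_connected_sphere[of "0::complex" 1] unfolding locally_connected by meson
  then obtain e where e: "e > 0" "ball x e \<inter> circle \<subseteq> U"
    using openin_contains_ball by metis
  have "monochrome U"
  proof -
    have "c u = c x" if "u \<in> U \<inter> X" for u
      using U(4) that by (auto simp: D_def)
    then show ?thesis
      unfolding monochrome_def by metis
  qed
  show thesis
  proof (rule that[OF e(1)])
    fix y assume y: "y \<in> X" "dist x y < e"
    then have "y \<in> U"
      using e(2) X_circle by (auto simp del: mem_sphere)
    then show "linked x y"
      using linkedI[OF x y(1) _ U(2,3)] U(4) \<open>monochrome U\<close> by blast
  qed
qed

lemma finite_blocks: "finite (block ` X)"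
proof -
  obtain e where e: "\<And>x. x \<in> X \<Longrightarrow> e x > 0" "\<And>x y. x \<in> X \<Longrightarrow> y \<in> X \<Longrightarrow> dist x y < e x \<Longrightarrow> linked x y"
  proof -
    have "\<exists>e. \<forall>x\<in>X. 0 < e x \<and> (\<forall>y\<in>X. dist x y < e x \<longrightarrow> linked x y)"
    proof (intro bchoice ballI)
      fix x assume "x \<in> X"
      then obtain e where "e > 0" "\<And>y. y \<in> X \<Longrightarrow> dist x y < e \<Longrightarrow> linked x y"
        using linked_near by blast
      then show "\<exists>e. 0 < e \<and> (\<forall>y\<in>X. dist x y < e \<longrightarrow> linked x y)"
        by blast
    qed
    then show thesis
      using that by blast
  qed
  have "compact X"
    using closed_X X_circle bounded_subset[OF bounded_sphere] by (auto simp: compact_eq_bounded_closed)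
  then obtain T where T: "T \<subseteq> X" "finite T" "X \<subseteq> (\<Union>x\<in>T. ball x (e x))"
    using e(1) by (elim compactE_image[of X X "\<lambda>x. ball x (e x)"]) force+
  have "block y \<in> block ` T" if y: "y \<in> X" for y
  proof -
    obtain x where "x \<in> T" "dist x y < e x"
      using T(3) y by (auto simp: subset_iff)
    then have "block x = block y"
      using e(2) T(1) y block_eq_iff by blast
    then show ?thesis
      using \<open>x \<in> T\<close> by auto
  qed
  then show ?thesis
    using T(2) finite_surj[of T "block ` X" block] by blast
qed

lemma compact_block: "compact (block x)"
proof -
  have "y \<in> block x" if y: "y \<in> closure (block x)" for y
  proof -
    have "y \<in> X"
      using y closure_minimal[OF block_subset closed_X] by blast
    then obtain e where "e > 0" "\<And>z. z \<in> X \<Longrightarrow> dist y z < e \<Longrightarrow> linked y z"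
      using linked_near by blast
    moreover from this obtain z where "z \<in> block x" "dist y z < e"
      using y unfolding closure_approachable by (metis dist_commute)
    ultimately show ?thesis
      using block_subset linked_sym linked_trans unfolding block_def by blast
  qed
  then have "closed (block x)"
    using closure_subset_eq by blast
  then show ?thesis
    using bounded_subset[OF bounded_sphere, of "block x" 0 1] block_subset[of x] X_circle
    by (simp add: compact_eq_bounded_closed)
qed

section \<open>Arcs spanned by blocks\<close>

lemma hull_exists:
  assumes x: "x \<in> X"
  shows "\<exists>a b. a \<in> block x \<and> b \<in> block x \<and> circle_interval a b \<inter> X = block x"
proof -
  obtain p where p: "p \<in> X" "c p \<noteq> c x"
    using other_colour by blast
  have pc: "p \<in> circle" and bc: "block x \<subseteq> circle"
    using p X_circle block_subset by blast+
  have "block x \<subseteq> circle - {p}"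
    using p bc linked_colour by (auto simp: block_def)
  then have "continuous_on (block x) (ang p)"
    using continuous_on_subset[OF continuous_on_ang[OF pc]] by blast
  then obtain a b where ab: "a \<in> block x" "\<And>y. y \<in> block x \<Longrightarrow> ang p a \<le> ang p y"
    "b \<in> block x" "\<And>y. y \<in> block x \<Longrightarrow> ang p y \<le> ang p b"
    using continuous_attains_inf[OF compact_block, of x "ang p"]
      continuous_attains_sup[OF compact_block, of x "ang p"] self_in_block[OF x] by blast
  have abc: "a \<in> circle" "b \<in> circle"
    using ab(1,3) bc by blast+
  have ci: "z \<in> circle_interval a b \<longleftrightarrow> ang p a \<le> ang p z \<and> ang p z \<le> ang p b" if "z \<in> circle" for z
    using circle_interval_base[OF pc abc that] ab(2)[OF ab(3)] by simp
  have "linked a b"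
    using ab(1,3) linked_sym linked_trans unfolding block_def by blast
  then obtain C where C: "C \<subseteq> circle" "connected C" "a \<in> C" "b \<in> C" "monochrome C"
    unfolding linked_def by blast
  have "p \<notin> C"
  proof
    assume "p \<in> C"
    then have "c p = c a"
      using monochromeD[OF C(5) _ C(3) p(1)] ab(1) block_subset by blast
    then show False
      using linked_colour[of x a] ab(1) p(2) by (simp add: block_def)
  qed
  have "z \<in> block x" if z: "z \<in> circle_interval a b" "z \<in> X" for z
  proof (cases "z = b")
    case False
    have zc: "z \<in> circle"
      using z X_circle by blast
    \<comment> \<open>The arc from \<open>p\<close> to \<open>z\<close> separates \<open>a\<close>
      from \<open>b\<close>. The set \<open>C\<close> joins these two and avoids \<open>p\<close>,
      so it has to pass through \<open>z\<close>, which puts \<open>z\<close> in the same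
      block.\<close>
    have "a \<in> circle_interval p z" "b \<notin> circle_interval p z"
      using ci[OF zc] z False ang_inject[OF pc zc abc(2)] abc
      by (auto simp: circle_interval_iff[OF pc zc])
    then have "z \<in> C"
      using connected_crosses_circle_interval[OF C(2,1) pc zc C(3) _ C(4)] \<open>p \<notin> C\<close> by blast
    then have "linked a z"
      using linkedI[OF _ _ C(1,2)] C(3,5) z(2) ab(1) block_subset by blast
    then show ?thesis
      using ab(1) linked_trans unfolding block_def by blast
  qed (use ab in simp)
  moreover have "block x \<subseteq> circle_interval a b \<inter> X"
    using ab ci bc block_subset by blast
  ultimately show ?thesis
    using ab by blast
qed

definition hull_ends :: "complex set \<Rightarrow> complex \<times> complex" where
  "hull_ends B = (SOME (a, b). a \<in> B \<and> b \<in> B \<and> circle_interval a b \<inter> X = B)"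

definition block_hull :: "complex set \<Rightarrow> complex set" where
  "block_hull B = circle_interval (fst (hull_ends B)) (snd (hull_ends B))"

lemma hull_ends_in:
  assumes "B \<in> block ` X"
  shows "fst (hull_ends B) \<in> B" "snd (hull_ends B) \<in> B" "block_hull B \<inter> X = B"
proof -
  have "\<exists>ab. case ab of (a, b) \<Rightarrow> a \<in> B \<and> b \<in> B \<and> circle_interval a b \<inter> X = B"
    using assms hull_exists by auto
  from someI_ex[OF this] show "fst (hull_ends B) \<in> B" "snd (hull_ends B) \<in> B" "block_hull B \<inter> X = B"
    unfolding hull_ends_def[symmetric] block_hull_def by (auto split: prod.splits)
qed

lemma monochrome_block: "C \<inter> X \<subseteq> block x \<Longrightarrow> monochrome C"
  using linked_colour[of x] unfolding monochrome_def block_def by (metis mem_Collect_eq subsetD)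

text \<open>Both arcs miss a point \<open>p\<close> of another colour, so seen from \<open>p\<close>
  they are ordinary intervals, and the hull contains both ends of the other one. Without such a
  \<open>p\<close>, the arc from \<open>u\<close> to \<open>v\<close> might go the long way
  round.\<close>

lemma monochrome_arc_subset_hull:
  assumes uv: "u \<in> X" "v \<in> X" "monochrome (circle_interval u v)"
  shows "circle_interval u v \<subseteq> block_hull (block u)"
proof
  fix z assume z: "z \<in> circle_interval u v"
  define a b where "a = fst (hull_ends (block u))" and "b = snd (hull_ends (block u))"
  have B: "block u \<in> block ` X"
    using uv by blast
  have uvc: "u \<in> circle" "v \<in> circle" and zc: "z \<in> circle"
    using uv X_circle z circle_interval_endpoints(3)[of u v] by blast+
  have ab: "a \<in> block u" "b \<in> block u" "circle_interval a b \<inter> X = block u"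
    using hull_ends_in[OF B] by (auto simp: a_def b_def block_hull_def)
  then have abc: "a \<in> circle" "b \<in> circle"
    using block_subset X_circle by blast+
  obtain p where p: "p \<in> X" "c p \<noteq> c u"
    using other_colour by blast
  have pc: "p \<in> circle"
    using p X_circle by blast
  have ends: "u \<in> circle_interval u v" "v \<in> circle_interval u v"
    using circle_interval_endpoints[OF uvc] by auto
  have p_uv: "p \<notin> circle_interval u v"
    using monochromeD[OF uv(3) _ ends(1) p(1) uv(1)] p(2) by blast
  have "linked u v"
    by (rule linkedI[OF uv(1,2) circle_interval_endpoints(3)[OF uvc] connected_circle_interval ends uv(3)])
  then have "u \<in> circle_interval a b" "v \<in> circle_interval a b"
    using ab(3) self_in_block[OF uv(1)] by (auto simp: block_def)
  moreover have "p \<notin> circle_interval a b"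
    using ab(3) p linked_colour[of u p] by (auto simp: block_def)
  ultimately have "z \<in> circle_interval a b"
    using z p_uv ang_ge_0[of p u] ang_ge_0[of p a] ang_ge_0[of p v] ang_ge_0[of p b] ang_refl[OF pc]
    unfolding circle_interval_base[OF pc uvc zc] circle_interval_base[OF pc uvc pc]
      circle_interval_base[OF pc abc zc] circle_interval_base[OF pc abc pc]
      circle_interval_base[OF pc abc uvc(1)] circle_interval_base[OF pc abc uvc(2)]
    by (smt (verit))
  then show "z \<in> block_hull (block u)"
    by (simp add: block_hull_def a_def b_def)
qed

lemma hull_props:
  assumes "B \<in> block ` X"
  shows "closed (block_hull B)" "connected (block_hull B)" "block_hull B \<subseteq> circle" "B \<subseteq> block_hull B" "B \<noteq> {}"
proof -
  have "fst (hull_ends B) \<in> circle" "snd (hull_ends B) \<in> circle"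
    using hull_ends_in[OF assms] block_subset X_circle assms by blast+
  then show "block_hull B \<subseteq> circle"
    unfolding block_hull_def by (rule circle_interval_endpoints(3))
qed (use hull_ends_in[OF assms] in \<open>auto simp: block_hull_def compact_imp_closed compact_circle_interval
  connected_circle_interval\<close>)

text \<open>If two hulls met, the second, being connected and containing points of its block outside
  the first, would contain an end of the first. That end lies in \<open>X\<close>, so it would
  belong to both blocks.\<close>

lemma hull_disjoint:
  assumes B: "B \<in> block ` X" "B' \<in> block ` X" "B \<noteq> B'"
  shows "block_hull B \<inter> block_hull B' = {}"
proof (rule ccontr)
  assume "block_hull B \<inter> block_hull B' \<noteq> {}"
  then obtain z where z: "z \<in> block_hull B" "z \<in> block_hull B'"
    by blast
  obtain w where w: "w \<in> B'"
    using hull_props(5)[OF B(2)] by blast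
  have disj: "B \<inter> B' = {}"
    using B block_cases by blast
  have "w \<in> block_hull B'" "w \<notin> block_hull B"
    using hull_ends_in(3)[OF B(1)] hull_props(4)[OF B(2)] w disj block_cases[OF B(2)] by blast+
  then have "fst (hull_ends B) \<in> block_hull B' \<or> snd (hull_ends B) \<in> block_hull B'"
    using z hull_props(3)[OF B(1)] hull_ends_in[OF B(1)] X_circle block_cases[OF B(1)]
    by (intro connected_crosses_circle_interval[OF hull_props(2,3)[OF B(2)] _ _ z(2) z(1)[unfolded block_hull_def]])
      (auto simp: block_hull_def)
  then show False
    using hull_ends_in[OF B(1)] hull_ends_in(3)[OF B(2)] disj block_cases[OF B(1)] by blast
qed

text \<open>This turns counting connected components into counting blocks.\<close>

lemma components_Union_hulls:
  assumes "\<B> \<subseteq> block ` X"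
  shows "components (\<Union>(block_hull ` \<B>)) = block_hull ` \<B>" "card (block_hull ` \<B>) = card \<B>"
proof -
  show "components (\<Union>(block_hull ` \<B>)) = block_hull ` \<B>"
  proof (rule components_Union_disjoint_closed)
    show "finite (block_hull ` \<B>)"
      using finite_subset[OF assms finite_blocks] by simp
    show "pairwise disjnt (block_hull ` \<B>)"
      by (rule pairwise_imageI) (use hull_disjoint assms in \<open>simp add: disjnt_def subset_iff\<close>)
  next
    fix A assume "A \<in> block_hull ` \<B>"
    then obtain B where "B \<in> block ` X" "A = block_hull B"
      using assms by blast
    then show "closed A \<and> connected A \<and> A \<noteq> {}"
      using hull_props[of B] by blast
  qed
  have "inj_on block_hull \<B>"
    using hull_ends_in(3) assms by (metis inj_onI subsetD)
  then show "card (block_hull ` \<B>) = card \<B>"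
    by (rule card_image)
qed

section \<open>Action of colour-respecting maps on blocks\<close>

definition respects_colour :: "(complex \<Rightarrow> complex) \<Rightarrow> bool" where
  "respects_colour g \<longleftrightarrow> g \<in> circle_Hom \<and> g ` X \<subseteq> X \<and>
     (\<forall>x\<in>X. \<forall>y\<in>X. c (g x) = c (g y) \<longleftrightarrow> c x = c y)"

context
  fixes g assumes g: "respects_colour g"
begin

lemma respects_colour_Hom: "g \<in> circle_Hom" and respects_colour_in: "x \<in> X \<Longrightarrow> g x \<in> X"
  and respects_colour_iff: "x \<in> X \<Longrightarrow> y \<in> X \<Longrightarrow> c (g x) = c (g y) \<longleftrightarrow> c x = c y"
  using g by (auto simp: respects_colour_def)

text \<open>Points of \<open>X\<close> in the preimage of a witness are sent into the witness and
  into \<open>X\<close>, so they have one colour after applying \<open>g\<close> and hence before.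
  The map may permute the colours, since only their equality is transported.\<close>

lemma linked_reflect:
  assumes "x \<in> X" "y \<in> X" "linked (g x) (g y)"
  shows "linked x y"
proof -
  obtain C where C: "C \<subseteq> circle" "connected C" "g x \<in> C" "g y \<in> C" "monochrome C"
    using assms(3) unfolding linked_def by blast
  obtain h where h: "homeomorphism circle circle g h"
    using respects_colour_Hom by (auto simp: circle_Hom_def)
  have gh: "\<And>z. z \<in> circle \<Longrightarrow> g (h z) = z" "\<And>z. z \<in> circle \<Longrightarrow> h (g z) = z" "h ` circle = circle"
    using h by (auto simp: homeomorphism_def)
  have "connected (h ` C)"
    using h C(1,2) by (intro connected_continuous_image) (auto simp: homeomorphism_def elim: continuous_on_subset)
  moreover have "h ` C \<subseteq> circle"
    using gh(3) C(1) by blast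
  moreover have "x \<in> h ` C" "y \<in> h ` C"
    using gh(2) C(3,4) assms X_circle by (metis imageI subsetD)+
  moreover have "monochrome (h ` C)"
    unfolding monochrome_def
  proof (intro ballI)
    fix u v assume uv: "u \<in> h ` C \<inter> X" "v \<in> h ` C \<inter> X"
    then have "g u \<in> C \<inter> X" "g v \<in> C \<inter> X"
      using gh(1) C(1) respects_colour_in by auto
    then show "c u = c v"
      using monochromeD[OF C(5), of "g u" "g v"] uv respects_colour_iff by blast
  qed
  ultimately show ?thesis
    using assms by (intro linkedI[of x y "h ` C"])
qed

text \<open>Pulling back by \<open>g\<close> sends the blocks that meet \<open>g ` X\<close> onto all blocks; as there are only
  finitely many blocks, this is a bijection of the set of blocks.\<close>

lemma
  shows linked_image: "linked x y \<Longrightarrow> linked (g x) (g y)"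
    and linked_to_image: "w \<in> X \<Longrightarrow> \<exists>x\<in>X. linked w (g x)"
proof -
  define R where "R = (\<lambda>x. block (g x)) ` X"
  \<comment> \<open>The choice of preimage is immaterial: by \<open>linked_reflect\<close>, any two
    preimages of points of one block are linked.\<close>
  define \<psi> where "\<psi> B = block (SOME x. x \<in> X \<and> g x \<in> B)" for B
  have R: "R \<subseteq> block ` X"
    using respects_colour_in by (auto simp: R_def)
  have \<psi>: "\<psi> (block (g x)) = block x" if x: "x \<in> X" for x
  proof -
    let ?y = "SOME y. y \<in> X \<and> g y \<in> block (g x)"
    have "?y \<in> X \<and> g ?y \<in> block (g x)"
      by (rule someI[of _ x]) (use x respects_colour_in self_in_block in blast)
    then have "linked x ?y"
      using linked_reflect x by (simp add: block_def)
    then show ?thesis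
      using block_eq_iff[OF x] unfolding \<psi>_def by metis
  qed
  then have img: "\<psi> ` R = block ` X"
    by (force simp: R_def)
  have fR: "finite R"
    using R finite_blocks finite_subset by blast
  have "card (block ` X) \<le> card R"
    using card_image_le[OF fR, of \<psi>] img by simp
  then have R_eq: "R = block ` X"
    using card_seteq[OF finite_blocks R] by blast
  then have inj: "inj_on \<psi> R"
    using eq_card_imp_inj_on[OF fR, of \<psi>] img by simp
  show "linked (g x) (g y)" if "linked x y"
  proof -
    have xy: "x \<in> X" "y \<in> X"
      using that linked_in by auto
    have "\<psi> (block (g x)) = \<psi> (block (g y))"
      using \<psi> xy block_eq_iff that by simp
    then have "block (g x) = block (g y)"
      using inj xy by (auto simp: R_def dest: inj_onD)
    then show ?thesis
      using block_eq_iff xy respects_colour_in by blast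
  qed
  show "\<exists>x\<in>X. linked w (g x)" if "w \<in> X"
  proof -
    have "block w \<in> R"
      using that R_eq by blast
    then show ?thesis
      using block_eq_iff that by (auto simp: R_def)
  qed
qed

lemma image_arc:
  assumes "u \<in> X" "v \<in> X"
  shows "g ` circle_interval u v = circle_interval (g u) (g v) \<or>
    g ` circle_interval u v = circle_interval (g v) (g u)"
  using circle_Hom_preserves_or_reverses_arcs[OF respects_colour_Hom] image_circle_interval[OF respects_colour_Hom] assms X_circle
  by (meson subsetD)

text \<open>A point \<open>w\<close> of \<open>X\<close> on the image arc need not itself be an
  image of a point of \<open>X\<close>, but it is linked to some \<open>g x\<close>. If
  \<open>x\<close> is off the arc, the connected witness from \<open>w\<close> to \<open>g x\<close>
  must leave the image arc through one of its ends.\<close>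

lemma image_arc_crossing:
  assumes uv: "u \<in> X" "v \<in> X" and w: "w \<in> g ` circle_interval u v" "w \<in> X"
  shows "(\<exists>x\<in>X \<inter> circle_interval u v. linked w (g x)) \<or> linked w (g u) \<or> linked w (g v)"
proof -
  obtain x where x: "x \<in> X" "linked w (g x)"
    using linked_to_image w by blast
  then obtain C where C: "C \<subseteq> circle" "connected C" "w \<in> C" "g x \<in> C" "monochrome C"
    unfolding linked_def by blast
  have uvc: "u \<in> circle" "v \<in> circle" and guv: "g u \<in> X" "g v \<in> X" "g u \<in> circle" "g v \<in> circle"
    using uv respects_colour_in X_circle by blast+
  show ?thesis
  proof (cases "g x \<in> g ` circle_interval u v")
    case True
    then have "x \<in> circle_interval u v"
      using inj_on_image_mem_iff[OF circle_HomD(3)[OF respects_colour_Hom], of x] x X_circle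
        circle_interval_endpoints(3)[OF uvc] by blast
    then show ?thesis
      using x by blast
  next
    case False
    then have "g u \<in> C \<or> g v \<in> C"
      using image_arc[OF uv] w(1)
        connected_crosses_circle_interval[OF C(2,1) guv(3,4) C(3) _ C(4)]
        connected_crosses_circle_interval[OF C(2,1) guv(4,3) C(3) _ C(4)] by metis
    then show ?thesis
      using linkedI[OF w(2) _ C(1,2,3) _ C(5)] guv by blast
  qed
qed

text \<open>All points of \<open>X\<close> on the image arc turn out to lie in the block of
  \<open>g u\<close>, so the image is a one-colour arc with ends in that block. A reversing
  \<open>g\<close> only exchanges these ends.\<close>

lemma image_hull_subset:
  assumes B: "B \<in> block ` X" and uv: "u \<in> B" "v \<in> B" "circle_interval u v \<subseteq> block_hull B"
  shows "g ` circle_interval u v \<subseteq> block_hull (block (g u))"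
proof -
  have X: "u \<in> X" "v \<in> X" "B = block u"
    using block_cases[OF B] uv by blast+
  then have uv_linked: "linked u v"
    using uv by (simp add: block_def)
  have "g ` circle_interval u v \<inter> X \<subseteq> block (g u)"
  proof
    fix w assume "w \<in> g ` circle_interval u v \<inter> X"
    then consider x where "x \<in> X \<inter> circle_interval u v" "linked w (g x)" | "linked w (g u)" | "linked w (g v)"
      using image_arc_crossing X by blast
    then show "w \<in> block (g u)"
    proof cases
      case 1
      then have "x \<in> block u"
        using uv(3) hull_ends_in(3)[OF B] X(3) by blast
      then show ?thesis
        using linked_image 1(2) linked_sym linked_trans unfolding block_def by blast
    next
      case 2
      then show ?thesis
        by (simp add: block_def linked_sym)
    next
      case 3
      then show ?thesis
        using linked_trans[OF linked_image[OF uv_linked] linked_sym] by (simp add: block_def)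
    qed
  qed
  then have mono: "monochrome (g ` circle_interval u v)"
    by (rule monochrome_block)
  have blocks_eq: "block (g v) = block (g u)"
    using block_eq_iff[OF respects_colour_in[OF X(1)]] linked_image[OF uv_linked] by blast
  show ?thesis
    using image_arc[OF X(1,2)]
  proof
    assume eq: "g ` circle_interval u v = circle_interval (g u) (g v)"
    show ?thesis
      unfolding eq by (rule monochrome_arc_subset_hull) (use mono respects_colour_in X in \<open>simp_all add: eq\<close>)
  next
    assume eq: "g ` circle_interval u v = circle_interval (g v) (g u)"
    show ?thesis
      unfolding eq blocks_eq[symmetric]
      by (rule monochrome_arc_subset_hull) (use mono respects_colour_in X in \<open>simp_all add: eq\<close>)
  qed
qed

end

end

section \<open>Contraction and counting of blocks\<close>

context coloured_set
begin

lemma hull_contracts: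
  assumes B: "B \<in> block ` X"
    and S: "\<And>g. g \<in> S \<Longrightarrow> respects_colour g \<and> preserves_arcs g"
    and close: "fst (hull_ends B) \<in> closure {g (snd (hull_ends B)) | g. g \<in> S}" and "\<epsilon> > 0"
  shows "\<exists>g\<in>S. \<forall>x\<in>block_hull B. dist (g x) (fst (hull_ends B)) < \<epsilon>"
proof -
  define a b where "a = fst (hull_ends B)" and "b = snd (hull_ends B)"
  have ab: "a \<in> B" "b \<in> B" "circle_interval a b \<inter> X = B" "block_hull B = circle_interval a b"
    using hull_ends_in[OF B] by (auto simp: a_def b_def block_hull_def)
  have aX: "a \<in> X" and bX: "b \<in> X" and Ba: "B = block a"
    using block_cases[OF B] ab by blast+
  have ac: "a \<in> circle" and bc: "b \<in> circle"
    using aX bX X_circle by blast+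
  have ab_linked: "linked a b"
    using ab(2) Ba by (simp add: block_def)
  obtain p where p: "p \<in> X" "c p \<noteq> c a"
    using other_colour by blast
  have pc: "p \<in> circle"
    using p X_circle by blast
  have p_hull: "p \<notin> circle_interval a b"
    using ab(3) p linked_colour[of a p] Ba by (auto simp: block_def)
  have ang_ab: "ang p a \<le> ang p b"
    using p_hull ang_refl[OF pc] circle_interval_base[OF pc ac bc pc] by (auto split: if_splits)
  have "a \<in> circle - {p}"
    using ac p by auto
  then obtain d where d: "d > 0" "\<And>z. z \<in> circle - {p} \<Longrightarrow> dist z a < d \<Longrightarrow> \<bar>ang p z - ang p a\<bar> < \<epsilon>"
    using continuous_on_ang[OF pc] \<open>\<epsilon> > 0\<close> unfolding continuous_on_iff dist_real_def by metis
  obtain e where e: "e > 0" "\<And>y. y \<in> X \<Longrightarrow> dist a y < e \<Longrightarrow> linked a y"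
    using linked_near[OF aX] by blast
  \<comment> \<open>The radius \<open>d\<close> makes the angle between \<open>a\<close> and
    \<open>g b\<close> smaller than \<open>\<epsilon>\<close>, while \<open>e\<close> makes
    \<open>g b\<close> fall into the block of \<open>a\<close>.\<close>
  have "min d e > 0"
    using d e by simp
  then obtain g where g: "g \<in> S" "dist (g b) a < min d e"
    using close unfolding closure_approachable a_def[symmetric] b_def[symmetric] by blast
  have gr: "respects_colour g" and gp: "preserves_arcs g"
    using S g by blast+
  have gaX: "g a \<in> X" and gbX: "g b \<in> X"
    using respects_colour_in[OF gr] aX bX by blast+
  then have gac: "g a \<in> circle" and gbc: "g b \<in> circle"
    using X_circle by blast+
  have "linked a (g b)"
    using e(2)[OF gbX] g(2) by (simp add: dist_commute)
  \<comment> \<open>Once \<open>g b\<close> has returned to the block, so has \<open>g a\<close>,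
    because \<open>g\<close> maps linked points to linked points. Hence \<open>g\<close> maps the
    hull into itself and \<open>g a\<close> cannot lie before \<open>a\<close>.\<close>
  then have "linked a (g a)"
    using linked_trans linked_sym linked_image[OF gr ab_linked] by blast
  then have Bg: "block (g a) = B"
    using block_eq_iff[OF aX] Ba by blast
  have img: "g ` circle_interval a b = circle_interval (g a) (g b)"
    by (rule image_circle_interval(1)[OF respects_colour_Hom[OF gr] ac bc gp])
  have sub: "circle_interval (g a) (g b) \<subseteq> circle_interval a b"
    using image_hull_subset[OF gr B ab(1,2)] ab(4) Bg img by simp
  have "g b \<noteq> p"
    using \<open>linked a (g b)\<close> p linked_colour by metis
  then have near: "\<bar>ang p (g b) - ang p a\<bar> < \<epsilon>"
    using d(2)[of "g b"] gbc g(2) by simp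
  have ang_gab: "ang p (g a) \<le> ang p (g b)"
    using sub p_hull ang_refl[OF pc] circle_interval_base[OF pc gac gbc pc]
    by (auto split: if_splits)
  have "dist (g x) a < \<epsilon>" if x: "x \<in> circle_interval a b" for x
  proof -
    have gx: "g x \<in> circle_interval (g a) (g b)"
      using img x by blast
    then have gxc: "g x \<in> circle"
      using circle_interval_endpoints(3)[OF gac gbc] by blast
    have "ang p (g x) \<le> ang p (g b)"
      using gx ang_gab circle_interval_base[OF pc gac gbc gxc] by simp
    moreover have "ang p a \<le> ang p (g x)"
      using gx sub ang_ab circle_interval_base[OF pc ac bc gxc] by auto
    ultimately show ?thesis
      using dist_circle_le_ang[OF pc gxc ac] near by linarith
  qed
  then show ?thesis
    using g(1) ab(4) by (auto simp: a_def)
qed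

section \<open>Number of blocks met by an arc\<close>

definition blocks_between :: "complex \<Rightarrow> complex \<Rightarrow> complex set set" where
  "blocks_between x y = {B \<in> block ` X. B \<inter> circle_interval x y \<noteq> {}}"

lemma blocks_betweenI: "w \<in> X \<Longrightarrow> w \<in> circle_interval x y \<Longrightarrow> block w \<in> blocks_between x y"
  unfolding blocks_between_def using self_in_block by blast

lemma blocks_betweenE:
  assumes "B \<in> blocks_between x y"
  obtains w where "w \<in> X" "w \<in> circle_interval x y" "B = block w"
  using assms block_cases unfolding blocks_between_def by blast

text \<open>The cardinality acts as an oriented combinatorial distance. The map \<open>m\<close>
  induced by \<open>g\<close> on blocks is onto the blocks met by the image arc by
  \<open>image_arc_crossing\<close>, and injective by \<open>linked_reflect\<close>.\<close>

lemma card_blocks_between_image: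
  assumes g: "respects_colour g" "preserves_arcs g" and xy: "x \<in> X" "y \<in> X"
  shows "card (blocks_between (g x) (g y)) = card (blocks_between x y)"
proof -
  define m where "m B = block (g (SOME z. z \<in> B))" for B
  have m: "m (block z) = block (g z)" if z: "z \<in> X" for z
  proof -
    have "(SOME y. y \<in> block z) \<in> block z"
      using self_in_block[OF z] by (rule someI)
    then have "linked (g z) (g (SOME y. y \<in> block z))"
      using linked_image[OF g(1)] by (simp add: block_def)
    then show ?thesis
      using block_eq_iff[OF respects_colour_in[OF g(1) z]] unfolding m_def by metis
  qed
  have xyc: "x \<in> circle" "y \<in> circle"
    using xy X_circle by blast+
  have ends: "x \<in> circle_interval x y" "y \<in> circle_interval x y"
    using circle_interval_endpoints[OF xyc] by auto
  have img: "g ` circle_interval x y = circle_interval (g x) (g y)"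
    by (rule image_circle_interval(1)[OF respects_colour_Hom[OF g(1)] xyc g(2)])
  have "blocks_between (g x) (g y) = m ` blocks_between x y"
  proof (intro equalityI subsetI)
    fix B assume "B \<in> blocks_between (g x) (g y)"
    then obtain w where w: "w \<in> X" "w \<in> g ` circle_interval x y" "B = block w"
      unfolding img by (rule blocks_betweenE)
    then obtain z where z: "z \<in> X" "z \<in> circle_interval x y" "linked w (g z)"
      using image_arc_crossing[OF g(1) xy w(2,1)] xy ends by blast
    then have "B = m (block z)"
      using block_eq_iff[OF w(1)] w(3) m by simp
    then show "B \<in> m ` blocks_between x y"
      using blocks_betweenI[OF z(1,2)] by blast
  next
    fix B assume "B \<in> m ` blocks_between x y"
    then obtain B' where B': "B' \<in> blocks_between x y" "B = m B'"
      by blast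
    obtain w where w: "w \<in> X" "w \<in> circle_interval x y" "B' = block w"
      using B'(1) by (rule blocks_betweenE)
    then have "g w \<in> circle_interval (g x) (g y)"
      using img by blast
    then show "B \<in> blocks_between (g x) (g y)"
      using blocks_betweenI respects_colour_in[OF g(1) w(1)] m w B'(2) by simp
  qed
  moreover have "inj_on m (blocks_between x y)"
  proof (rule inj_onI)
    fix B B' assume B: "B \<in> blocks_between x y" "B' \<in> blocks_between x y" "m B = m B'"
    obtain w where w: "w \<in> X" "B = block w"
      using B(1) by (rule blocks_betweenE)
    obtain w' where w': "w' \<in> X" "B' = block w'"
      using B(2) by (rule blocks_betweenE)
    have "linked (g w) (g w')"
      using B(3) m w w' block_eq_iff[OF respects_colour_in[OF g(1) w(1)]] by simp
    then have "linked w w'"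
      using linked_reflect[OF g(1) w(1) w'(1)] by blast
    then show "B = B'"
      using block_eq_iff[OF w(1)] w w' by simp
  qed
  ultimately show ?thesis
    using card_image by metis
qed

text \<open>Moving the target within its block changes nothing: the witness from \<open>y\<close> to
  \<open>y'\<close> can cross neither \<open>x\<close> nor a point \<open>w\<close> outside the
  block of \<open>y\<close>. Applied in both directions, the inclusion becomes an equality.\<close>

lemma blocks_between_mono_target:
  assumes xy: "x \<in> X" "linked y y'" "\<not> linked x y"
  shows "blocks_between x y \<subseteq> blocks_between x y'"
proof
  fix B assume "B \<in> blocks_between x y"
  then obtain w where w: "w \<in> X" "w \<in> circle_interval x y" "B = block w"
    by (rule blocks_betweenE)
  have yX: "y \<in> X" "y' \<in> X"
    using xy(2) linked_in by blast+
  have circ: "x \<in> circle" "y \<in> circle" "y' \<in> circle" "w \<in> circle"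
    using xy(1) yX w(1) X_circle by blast+
  have x_y': "\<not> linked x y'"
    using xy(2,3) linked_sym linked_trans by blast
  then have ne: "x \<noteq> y" "x \<noteq> y'"
    using linked_refl[OF xy(1)] xy(3) by auto
  show "B \<in> blocks_between x y'"
  proof (cases "linked w y \<or> w = x")
    case True
    then show ?thesis
    proof
      assume "linked w y"
      then have "B = block y'"
        using block_eq_iff[OF w(1)] linked_trans[OF _ xy(2)] w(3) by simp
      then show ?thesis
        using blocks_betweenI[OF yX(2)] circle_interval_endpoints(2)[OF circ(1,3)] by simp
    next
      assume "w = x"
      then show ?thesis
        using blocks_betweenI[OF xy(1)] circle_interval_endpoints(1)[OF circ(1,3)] w(3) by simp
    qed
  next
    case False
    obtain C where C: "C \<subseteq> circle" "connected C" "y \<in> C" "y' \<in> C" "monochrome C"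
      using xy(2) unfolding linked_def by blast
    have "x \<notin> C" "w \<notin> C"
      using linkedI[OF _ yX(1) C(1,2) _ C(3,5)] xy(1,3) w(1) False by blast+
    moreover have "y \<in> circle_interval w x"
      using circle_interval_rotate[OF circ(1,2,4) ne(1)] w(2) False by blast
    ultimately have "y' \<in> circle_interval w x"
      using connected_crosses_circle_interval[OF C(2,1) circ(4,1) C(3) _ C(4)] by blast
    then have "w \<in> circle_interval x y'"
      using circle_interval_rotate[OF circ(1,3,4) ne(2)] False by blast
    then show ?thesis
      using blocks_betweenI[OF w(1)] w(3) by simp
  qed
qed

text \<open>Seen from \<open>y\<close>, the point \<open>x'\<close> comes after \<open>x\<close>, so
  the arc to \<open>y\<close> gets shorter. It loses the block of \<open>x\<close>, since a witness
  from \<open>x\<close> to a point of the shorter arc would enter it through \<open>x'\<close> or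
  \<open>y\<close>.\<close>

lemma blocks_between_psubset:
  assumes X: "x \<in> X" "x' \<in> X" "y \<in> X" and ang: "ang y x < ang y x'"
    and nl: "\<not> linked x x'" "\<not> linked x y" "\<not> linked x' y"
  shows "blocks_between x' y \<subset> blocks_between x y"
proof -
  have circ: "x \<in> circle" "x' \<in> circle" "y \<in> circle"
    using X X_circle by blast+
  have "x \<noteq> y" "x' \<noteq> y"
    using nl linked_refl[OF X(3)] by auto
  then have pos: "ang y x > 0" "ang y x' > 0"
    using ang_pos circ by blast+
  have ci: "z \<in> circle_interval x y \<longleftrightarrow> ang y x \<le> ang y z \<or> ang y z \<le> 0"
    "z \<in> circle_interval x' y \<longleftrightarrow> ang y x' \<le> ang y z \<or> ang y z \<le> 0" if "z \<in> circle" for z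
    using circle_interval_base[OF circ(3,1,3) that] circle_interval_base[OF circ(3,2,3) that] pos
      ang_refl[OF circ(3)] by auto
  have "blocks_between x' y \<subseteq> blocks_between x y"
  proof
    fix B assume "B \<in> blocks_between x' y"
    then obtain w where w: "w \<in> X" "w \<in> circle_interval x' y" "B = block w"
      by (rule blocks_betweenE)
    moreover have "w \<in> circle"
      using w(1) X_circle by blast
    ultimately show "B \<in> blocks_between x y"
      using ci[of w] ang blocks_betweenI[of w x y] by auto
  qed
  moreover have "block x \<in> blocks_between x y"
    using blocks_betweenI[OF X(1)] circle_interval_endpoints(1)[OF circ(1,3)] by blast
  moreover have "block x \<notin> blocks_between x' y"
  proof
    assume "block x \<in> blocks_between x' y"
    then obtain w where w: "w \<in> X" "w \<in> circle_interval x' y" "block x = block w"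
      by (rule blocks_betweenE)
    then have "linked x w"
      using block_eq_iff[OF X(1)] by blast
    then obtain C where C: "C \<subseteq> circle" "connected C" "x \<in> C" "w \<in> C" "monochrome C"
      unfolding linked_def by blast
    have "x \<notin> circle_interval x' y"
      using ci(2)[OF circ(1)] ang pos by simp
    then have "x' \<in> C \<or> y \<in> C"
      using connected_crosses_circle_interval[OF C(2,1) circ(2,3) C(4) w(2) C(3)] by blast
    then show False
      using linkedI[OF X(1) _ C(1,2,3) _ C(5)] X nl by blast
  qed
  ultimately show ?thesis
    by blast
qed

text \<open>With the target fixed, the count drops strictly from one block to the next one
  counterclockwise, so it identifies the block of the source.\<close>

lemma linked_if_card_blocks_between_eq:
  assumes X: "x \<in> X" "x' \<in> X" "y \<in> X" and nl: "\<not> linked x y" "\<not> linked x' y"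
    and eq: "card (blocks_between x y) = card (blocks_between x' y)"
  shows "linked x x'"
proof (rule ccontr)
  assume l: "\<not> linked x x'"
  have fin: "finite (blocks_between u y)" for u
    using finite_blocks by (simp add: blocks_between_def)
  have circ: "x \<in> circle" "x' \<in> circle" "y \<in> circle"
    using X X_circle by blast+
  have "x \<noteq> x'"
    using l linked_refl[OF X(1)] by auto
  then consider "ang y x < ang y x'" | "ang y x' < ang y x"
    using ang_inject[OF circ(3,1,2)] by linarith
  then show False
  proof cases
    case 1
    then show ?thesis
      using psubset_card_mono[OF fin blocks_between_psubset[OF X 1 l nl]] eq by simp
  next
    case 2
    have "\<not> linked x' x"
      using l linked_sym by blast
    then show ?thesis
      using psubset_card_mono[OF fin blocks_between_psubset[OF X(2,1,3) 2 _ nl(2,1)]] eq by simp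
  qed
qed

text \<open>Every block of the colour of \<open>x\<close> is the block of \<open>g x\<close> for
  some \<open>g\<close> in \<open>S\<close>; it is sent to the block of \<open>g y\<close>. All
  these pairs are at the same combinatorial distance, so the target block together with this
  distance recovers the source block.\<close>

lemma card_blocks_le:
  assumes S: "\<And>g. g \<in> S \<Longrightarrow> respects_colour g \<and> preserves_arcs g"
    and S_colour: "\<And>g x. g \<in> S \<Longrightarrow> x \<in> X \<Longrightarrow> c (g x) = c x"
    and trans: "\<And>x y. x \<in> X \<Longrightarrow> y \<in> X \<Longrightarrow> c x = c y \<Longrightarrow> \<exists>g\<in>S. linked y (g x)"
    and xy: "x \<in> X" "y \<in> X" "c x \<noteq> c y"
  shows "card (block ` {z \<in> X. c z = c x}) \<le> card (block ` {z \<in> X. c z = c y})"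
proof -
  have "\<forall>B\<in>block ` {z \<in> X. c z = c x}. \<exists>g. g \<in> S \<and> B = block (g x)"
  proof
    fix B assume "B \<in> block ` {z \<in> X. c z = c x}"
    then obtain z where z: "z \<in> X" "c z = c x" "B = block z"
      by blast
    then obtain g where "g \<in> S" "linked z (g x)"
      using trans[OF xy(1) z(1)] by auto
    then show "\<exists>g. g \<in> S \<and> B = block (g x)"
      using z block_eq_iff[OF z(1)] by blast
  qed
  from bchoice[OF this] obtain h
    where h: "\<And>B. B \<in> block ` {z \<in> X. c z = c x} \<Longrightarrow> h B \<in> S \<and> B = block (h B x)"
    by blast
  define f where "f B = block (h B y)" for B
  have in_X: "g x \<in> X" "g y \<in> X" "\<not> linked (g x) (g y)" if "g \<in> S" for g
    using that S respects_colour_in xy S_colour linked_colour by metis+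
  have "inj_on f (block ` {z \<in> X. c z = c x})"
  proof (rule inj_onI)
    fix B B' assume B: "B \<in> block ` {z \<in> X. c z = c x}" "B' \<in> block ` {z \<in> X. c z = c x}" "f B = f B'"
    define g g' where "g = h B" and "g' = h B'"
    have g: "g \<in> S" "B = block (g x)" "g' \<in> S" "B' = block (g' x)"
      using h B by (auto simp: g_def g'_def)
    note gX = in_X[OF g(1)] and g'X = in_X[OF g(3)]
    have "block (g y) = block (g' y)"
      using B(3) by (simp add: f_def g_def g'_def)
    then have l: "linked (g y) (g' y)" "linked (g' y) (g y)"
      using block_eq_iff[OF gX(2)] linked_sym by blast+
    have nl: "\<not> linked (g' x) (g y)"
      using g'X(3) l linked_trans by blast
    have "card (blocks_between (g x) (g y)) = card (blocks_between (g' x) (g' y))"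
      using card_blocks_between_image[OF _ _ xy(1,2)] S g by metis
    \<comment> \<open>The targets \<open>g y\<close> and \<open>g' y\<close> lie in one block, so
      they may be exchanged; this brings both counts to a common target.\<close>
    also have "blocks_between (g' x) (g' y) = blocks_between (g' x) (g y)"
      using blocks_between_mono_target[OF g'X(1) l(1) nl]
        blocks_between_mono_target[OF g'X(1) l(2) g'X(3)] by blast
    finally have "linked (g x) (g' x)"
      using linked_if_card_blocks_between_eq[OF gX(1) g'X(1) gX(2,3) nl] by blast
    then show "B = B'"
      using g block_eq_iff[OF gX(1)] by simp
  qed
  moreover have "f ` block ` {z \<in> X. c z = c x} \<subseteq> block ` {z \<in> X. c z = c y}"
  proof
    fix B' assume "B' \<in> f ` block ` {z \<in> X. c z = c x}"
    then obtain B where B: "B \<in> block ` {z \<in> X. c z = c x}" "B' = f B"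
      by blast
    then have "h B y \<in> {z \<in> X. c z = c y}"
      using h[OF B(1)] in_X(2) S_colour xy(2) by blast
    then show "B' \<in> block ` {z \<in> X. c z = c y}"
      unfolding B(2) f_def by blast
  qed
  moreover have "finite (block ` {z \<in> X. c z = c y})"
    by (rule finite_subset[OF _ finite_blocks]) blast
  ultimately show ?thesis
    by (rule card_inj_on_le)
qed

end

section \<open>Orbit closures in minimal sets\<close>

lemma circle_Hom_comp:
  "f \<in> circle_Hom \<Longrightarrow> g \<in> circle_Hom \<Longrightarrow> f \<circ> g \<in> circle_Hom"
  unfolding circle_Hom_def using homeomorphism_compose by blast

lemma generated_semigroup_circle_Hom:
  assumes "F \<subseteq> circle_Hom" "g \<in> generated_semigroup F"
  shows "g \<in> circle_Hom"
  using assms(2) by induction (use assms(1) circle_Hom_comp in blast)+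

lemma arcs_comp:
  assumes "g \<in> circle_Hom"
  shows "preserves_arcs f \<Longrightarrow> preserves_arcs g \<Longrightarrow> preserves_arcs (f \<circ> g)"
    and "preserves_arcs f \<Longrightarrow> reverses_arcs g \<Longrightarrow> reverses_arcs (f \<circ> g)"
    and "reverses_arcs f \<Longrightarrow> preserves_arcs g \<Longrightarrow> reverses_arcs (f \<circ> g)"
    and "reverses_arcs f \<Longrightarrow> reverses_arcs g \<Longrightarrow> preserves_arcs (f \<circ> g)"
  using circle_HomD(4)[OF assms] by (simp_all add: preserves_arcs_def reverses_arcs_def del: mem_sphere)

lemma generated_semigroup_preserves_arcs:
  assumes "F \<subseteq> circle_Hom_plus" "g \<in> generated_semigroup F"
  shows "preserves_arcs g"
  using assms(2)
proof induction
  case (comp f g)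
  have "F \<subseteq> circle_Hom"
    using assms(1) by (auto simp: circle_Hom_plus_def)
  then show ?case
    using comp arcs_comp(1) generated_semigroup_circle_Hom by blast
qed (use assms(1) circle_Hom_plus_preserves_arcs in blast)

definition orbit_closure :: "(complex \<Rightarrow> complex) set \<Rightarrow> complex \<Rightarrow> complex set" where
  "orbit_closure S x = closure {g x | g. g \<in> S}"

lemma in_orbit_closure: "g \<in> S \<Longrightarrow> g x \<in> orbit_closure S x"
  unfolding orbit_closure_def by (rule subsetD[OF closure_subset]) blast

lemma orbit_closure_subset:
  assumes "closed K" "\<And>g. g \<in> S \<Longrightarrow> g ` K \<subseteq> K" "x \<in> K"
  shows "orbit_closure S x \<subseteq> K"
  unfolding orbit_closure_def by (rule closure_minimal[OF _ assms(1)]) (use assms(2,3) in blast)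

text \<open>Separate families for the inner maps and for the compositions let the same argument
  serve all four combinations of positive and negative maps.\<close>

lemma image_orbit_closure:
  assumes K: "orbit_closure T x \<subseteq> K" "continuous_on K s"
    and comp: "\<And>t. t \<in> T \<Longrightarrow> s \<circ> t \<in> U"
  shows "s ` orbit_closure T x \<subseteq> orbit_closure U x"
proof -
  have "s ` {t x |t. t \<in> T} \<subseteq> closure {u x |u. u \<in> U}"
  proof
    fix w assume "w \<in> s ` {t x |t. t \<in> T}"
    then obtain t where "t \<in> T" "w = (s \<circ> t) x"
      by auto
    then show "w \<in> closure {u x |u. u \<in> U}"
      using in_orbit_closure[OF comp] by (simp add: orbit_closure_def)
  qed
  then show ?thesis
    unfolding orbit_closure_def
    by (intro image_closure_subset) (use K continuous_on_subset in \<open>auto simp: orbit_closure_def\<close>)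
qed

lemma orbit_closure_trans:
  assumes "orbit_closure T x \<subseteq> K" "\<And>s. s \<in> S \<Longrightarrow> continuous_on K s"
    and "\<And>s t. s \<in> S \<Longrightarrow> t \<in> T \<Longrightarrow> s \<circ> t \<in> U" and "y \<in> orbit_closure T x"
  shows "orbit_closure S y \<subseteq> orbit_closure U x"
proof -
  have "{s y |s. s \<in> S} \<subseteq> orbit_closure U x"
    using image_orbit_closure[OF assms(1)] assms(2-4) by blast
  then show ?thesis
    unfolding orbit_closure_def[of S] by (rule closure_minimal) (simp add: orbit_closure_def)
qed

text \<open>The families \<open>S\<close> and \<open>T\<close> play the even and odd parts of a
  semigroup graded by parity, with orientation abstracted away; \<open>dense\<close> expresses
  minimality of \<open>K\<close>.\<close>

locale graded_minimal =
  fixes S T :: "(complex \<Rightarrow> complex) set" and K :: "complex set"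
  assumes closed_K: "closed K"
    and cont: "\<And>g. g \<in> S \<union> T \<Longrightarrow> continuous_on K g"
    and inv: "\<And>g. g \<in> S \<union> T \<Longrightarrow> g ` K \<subseteq> K"
    and SS: "\<And>f g. f \<in> S \<Longrightarrow> g \<in> S \<Longrightarrow> f \<circ> g \<in> S"
    and ST: "\<And>f g. f \<in> S \<Longrightarrow> g \<in> T \<Longrightarrow> f \<circ> g \<in> T"
    and TS: "\<And>f g. f \<in> T \<Longrightarrow> g \<in> S \<Longrightarrow> f \<circ> g \<in> T"
    and TT: "\<And>f g. f \<in> T \<Longrightarrow> g \<in> T \<Longrightarrow> f \<circ> g \<in> S"
    and S_nonempty: "S \<noteq> {}"
    and dense: "\<And>x. x \<in> K \<Longrightarrow> K \<subseteq> orbit_closure S x \<union> orbit_closure T x"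
begin

abbreviation "P \<equiv> orbit_closure S"
abbreviation "Q \<equiv> orbit_closure T"

lemma P_subset: "x \<in> K \<Longrightarrow> P x \<subseteq> K" and Q_subset: "x \<in> K \<Longrightarrow> Q x \<subseteq> K"
  using orbit_closure_subset[OF closed_K] inv by blast+

lemma P_trans: "x \<in> K \<Longrightarrow> y \<in> P x \<Longrightarrow> P y \<subseteq> P x"
  by (rule orbit_closure_trans[OF P_subset]) (auto intro: cont SS)

lemma QP_subset: "x \<in> K \<Longrightarrow> y \<in> P x \<Longrightarrow> Q y \<subseteq> Q x"
  by (rule orbit_closure_trans[OF P_subset]) (auto intro: cont TS)

lemma PQ_subset: "x \<in> K \<Longrightarrow> y \<in> Q x \<Longrightarrow> P y \<subseteq> Q x"
  by (rule orbit_closure_trans[OF Q_subset]) (auto intro: cont ST)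

lemma QQ_subset: "x \<in> K \<Longrightarrow> y \<in> Q x \<Longrightarrow> Q y \<subseteq> P x"
  by (rule orbit_closure_trans[OF Q_subset]) (auto intro: cont TT)

text \<open>If \<open>x\<close> is only known to be in \<open>Q y\<close>, an even return is made of
  two odd ones: \<open>Q y \<subseteq> Q x\<close> because \<open>y\<close> is in
  \<open>P x\<close>, and \<open>Q x \<subseteq> P y\<close> because \<open>x\<close> is in
  \<open>Q y\<close>.\<close>

lemma P_sym:
  assumes "x \<in> K" "y \<in> P x"
  shows "x \<in> P y"
proof -
  have y: "y \<in> K"
    using assms P_subset by blast
  then have "x \<in> P y \<union> Q y"
    using dense assms(1) by blast
  moreover have "x \<in> P y" if "x \<in> Q y"
    using that QP_subset[OF assms] QQ_subset[OF y that] by blast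
  ultimately show ?thesis
    by blast
qed

text \<open>The identity need not belong to \<open>S\<close>, so reflexivity comes from going to
  \<open>g x\<close> and back by symmetry.\<close>

lemma P_refl: "x \<in> K \<Longrightarrow> x \<in> P x"
proof -
  assume x: "x \<in> K"
  obtain g where "g \<in> S"
    using S_nonempty by blast
  then have "g x \<in> P x"
    by (rule in_orbit_closure)
  then show ?thesis
    using P_sym[OF x] P_trans[OF x] by blast
qed

lemma P_eq_iff:
  assumes "x \<in> K" "y \<in> K"
  shows "P y = P x \<longleftrightarrow> y \<in> P x"
proof
  assume "y \<in> P x"
  then show "P y = P x"
    using P_trans assms P_sym by blast
qed (use P_refl assms in blast)

text \<open>Points outside \<open>P x\<close> are related to \<open>x\<close> by odd maps, and
  passing from one to the other through \<open>x\<close> is a product of two odd steps, hence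
  even.\<close>

lemma at_most_two_classes:
  assumes "x \<in> K" "z \<in> K" "w \<in> K" "z \<notin> P x" "w \<notin> P x"
  shows "P z = P w"
proof -
  have "x \<in> Q w"
    using P_sym[of w x] dense[of w] assms by blast
  moreover have "z \<in> Q x"
    using dense assms by blast
  ultimately have "z \<in> P w"
    using QQ_subset[of w x] assms by blast
  then show ?thesis
    using P_eq_iff assms by blast
qed

text \<open>A common point puts \<open>x\<close> itself into \<open>Q x\<close>; then odd steps can
  be traded for even ones, and \<open>P x\<close> absorbs \<open>Q x\<close>.\<close>

lemma P_eq_K_if_overlap:
  assumes x: "x \<in> K" and u: "u \<in> P x" "u \<in> Q x"
  shows "P x = K"
proof -
  have "P x \<subseteq> P u"
    using P_trans P_sym u x P_subset by blast
  then have "x \<in> Q x"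
    using PQ_subset u x P_refl by blast
  then show ?thesis
    using QQ_subset[OF x] dense[OF x] P_subset[OF x] by blast
qed

lemma finite_classes: "finite (P ` K)"
proof (cases "\<exists>x z. x \<in> K \<and> z \<in> K \<and> z \<notin> P x")
  case True
  then obtain x z where xz: "x \<in> K" "z \<in> K" "z \<notin> P x"
    by blast
  have "P w = P x \<or> P w = P z" if "w \<in> K" for w
    using at_most_two_classes[of x w z] P_eq_iff that xz by blast
  then have "P ` K \<subseteq> {P x, P z}"
    by blast
  then show ?thesis
    using finite_subset by blast
next
  case False
  then have "P ` K \<subseteq> {K}"
    using P_subset by blast
  then show ?thesis
    using finite_subset by blast
qed

lemma P_image: "g \<in> S \<Longrightarrow> x \<in> K \<Longrightarrow> P (g x) = P x"
  using P_eq_iff[of x "g x"] in_orbit_closure[of g S x] P_subset by blast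

text \<open>Even maps fix every class. An odd map exchanges the classes when there are two, and
  there is nothing to show when there is only one.\<close>

lemma P_image_eq_iff:
  assumes g: "g \<in> S \<union> T" and xy: "x \<in> K" "y \<in> K"
  shows "P (g x) = P (g y) \<longleftrightarrow> P x = P y"
proof (cases "g \<in> S")
  case True
  then show ?thesis
    using P_image xy by simp
next
  case False
  then have gT: "g \<in> T"
    using g by blast
  have gK: "g x \<in> K" "g y \<in> K"
    using inv[OF g] xy by blast+
  have gQ: "g x \<in> Q x" "g y \<in> Q y"
    using in_orbit_closure[OF gT] by blast+
  show ?thesis
  proof (cases "P x = K \<or> P y = K")
    case True
    then have "P z = K" if "z \<in> K" for z
      using P_eq_iff that xy by metis
    then show ?thesis
      using gK xy by simp
  next
    case False
    then have out: "g x \<notin> P x" "g y \<notin> P y"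
      using P_eq_K_if_overlap xy gQ by blast+
    show ?thesis
    proof
      assume "P x = P y"
      then show "P (g x) = P (g y)"
        using at_most_two_classes[OF xy(1) gK] out by simp
    next
      assume eq: "P (g x) = P (g y)"
      show "P x = P y"
      proof (rule ccontr)
        assume "P x \<noteq> P y"
        then have "y \<notin> P x" "x \<notin> P y"
          using P_eq_iff xy by blast+
        then have "P (g x) = P y" "P (g y) = P x"
          using at_most_two_classes[OF xy(1) gK(1) xy(2)] at_most_two_classes[OF xy(2) gK(2) xy(1)] out
          by blast+
        then show False
          using eq \<open>P x \<noteq> P y\<close> by simp
      qed
    qed
  qed
qed

end

section \<open>Minimal sets of the generated semigroup\<close>

lemma no_finite_orbit_nonempty:
  assumes "no_finite_orbit F"
  obtains f where "f \<in> F"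
proof -
  have "g \<in> generated_semigroup F \<Longrightarrow> F \<noteq> {}" for g
    by (induction rule: generated_semigroup.induct) auto
  moreover have "infinite (orbit F 1)"
    using assms by (simp add: no_finite_orbit_def)
  then have "orbit F 1 \<noteq> {}"
    by auto
  ultimately show thesis
    using that unfolding orbit_def by blast
qed

lemma generated_semigroup_invariant:
  assumes "invariant_set F K" "g \<in> generated_semigroup F"
  shows "g ` K \<subseteq> K"
  using assms(2)
proof induction
  case (comp f g)
  then show ?case
    by (auto simp: image_subset_iff)
qed (use assms(1) in \<open>auto simp: invariant_set_def\<close>)

lemma invariant_minimal_orbit_closure:
  assumes F: "F \<subseteq> circle_Hom" "f \<in> F" and K: "invariant_minimal F K" and x: "x \<in> K"
  shows "orbit_closure (generated_semigroup F) x = K"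
proof (rule ccontr)
  assume ne: "orbit_closure (generated_semigroup F) x \<noteq> K"
  have K': "closed K" "invariant_set F K" "K \<subseteq> circle"
    using K by (auto simp: invariant_minimal_def invariant_set_def)
  have sub: "orbit_closure (generated_semigroup F) x \<subseteq> K"
    using orbit_closure_subset[OF K'(1) _ x] generated_semigroup_invariant[OF K'(2)] by blast
  have "h ` orbit_closure (generated_semigroup F) x \<subseteq> orbit_closure (generated_semigroup F) x"
    if "h \<in> F" for h
  proof (rule image_orbit_closure[OF sub])
    show "continuous_on K h"
      using that F(1) circle_HomD(1) K'(3) continuous_on_subset by blast
  qed (use that in \<open>auto intro: generated_semigroup.intros\<close>)
  \<comment> \<open>The given generator guarantees that the orbit closure is nonempty, as
    \<open>invariant_set\<close> demands.\<close>
  moreover have "f x \<in> orbit_closure (generated_semigroup F) x"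
    by (rule in_orbit_closure) (rule generated_semigroup.generator[OF F(2)])
  ultimately have "invariant_set F (orbit_closure (generated_semigroup F) x)"
    using sub K'(3) unfolding invariant_set_def by blast
  then show False
    using K sub ne unfolding invariant_minimal_def orbit_closure_def by blast
qed

lemma invariant_minimal_disjoint:
  assumes "invariant_minimal F K" "invariant_minimal F K'" "K \<noteq> K'"
  shows "K \<inter> K' = {}"
proof (rule ccontr)
  assume "K \<inter> K' \<noteq> {}"
  then have "closed (K \<inter> K')" "invariant_set F (K \<inter> K')"
    using assms unfolding invariant_minimal_def invariant_set_def by (auto simp: image_subset_iff)
  moreover have "K \<inter> K' \<subset> K \<or> K \<inter> K' \<subset> K'"
    using assms(3) by blast
  ultimately show False
    using assms(1,2) unfolding invariant_minimal_def by blast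
qed

text \<open>Uniform contraction of all of \<open>I\<close> towards one fixed point is stronger than
  proximality; the triangle inequality through \<open>a\<close> gives the bound.\<close>

lemma acts_proximallyI:
  assumes "\<And>\<epsilon>. \<epsilon> > 0 \<Longrightarrow> \<exists>g\<in>generated_semigroup F. \<forall>x\<in>I. dist (g x) a < \<epsilon>"
  shows "acts_proximally F I"
  unfolding acts_proximally_def
proof (intro ballI)
  fix x y assume xy: "x \<in> I" "y \<in> I"
  have "\<forall>n. \<exists>g. g \<in> generated_semigroup F \<and> (\<forall>x\<in>I. dist (g x) a < inverse (real (Suc n)))"
    using assms by (metis inverse_positive_iff_positive of_nat_0_less_iff zero_less_Suc)
  then obtain g where g: "\<And>n. g n \<in> generated_semigroup F"
    "\<And>n x. x \<in> I \<Longrightarrow> dist (g n x) a < inverse (real (Suc n))"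
    by metis
  have "(\<lambda>n. dist (g n x) (g n y)) \<longlonglongrightarrow> 0"
  proof (rule tendsto_sandwich[where f = "\<lambda>_. 0"])
    show "(\<lambda>n. 2 * inverse (real (Suc n))) \<longlonglongrightarrow> 0"
      using tendsto_mult_right[OF LIMSEQ_inverse_real_of_nat, of 2] by simp
    have "dist (g n x) (g n y) \<le> 2 * inverse (real (Suc n))" for n
      using dist_triangle2[of "g n x" "g n y" a] g(2)[OF xy(1), of n] g(2)[OF xy(2), of n] by linarith
    then show "\<forall>\<^sub>F n in sequentially. dist (g n x) (g n y) \<le> 2 * inverse (real (Suc n))"
      by simp
  qed auto
  then show "\<exists>g. (\<forall>n. g n \<in> generated_semigroup F) \<and> (\<lambda>n. dist (g n x) (g n y)) \<longlonglongrightarrow> 0"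
    using g(1) by blast
qed

lemma graded_minimal_semigroup:
  assumes F: "F \<subseteq> circle_Hom" "f \<in> F" and K: "invariant_minimal F K"
  shows "graded_minimal {g \<in> generated_semigroup F. preserves_arcs g}
    {g \<in> generated_semigroup F. reverses_arcs g} K"
proof -
  note hom = generated_semigroup_circle_Hom[OF F(1)]
  have K': "closed K" "invariant_set F K" "K \<subseteq> circle"
    using K by (auto simp: invariant_minimal_def invariant_set_def)
  have split: "generated_semigroup F =
    {g \<in> generated_semigroup F. preserves_arcs g} \<union> {g \<in> generated_semigroup F. reverses_arcs g}"
    using circle_Hom_preserves_or_reverses_arcs hom by blast
  show ?thesis
  proof
    show "closed K"
      by (rule K'(1))
    show "continuous_on K g"
      if "g \<in> {g \<in> generated_semigroup F. preserves_arcs g} \<union> {g \<in> generated_semigroup F. reverses_arcs g}" for g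
      using that hom circle_HomD(1) K'(3) continuous_on_subset by blast
    show "g ` K \<subseteq> K"
      if "g \<in> {g \<in> generated_semigroup F. preserves_arcs g} \<union> {g \<in> generated_semigroup F. reverses_arcs g}" for g
      using that generated_semigroup_invariant[OF K'(2)] by blast
    have "f \<in> generated_semigroup F"
      by (rule generated_semigroup.generator[OF F(2)])
    \<comment> \<open>The square of any generator is positive, whichever orientation behaviour the
      generator has.\<close>
    then have "f \<circ> f \<in> generated_semigroup F" "preserves_arcs (f \<circ> f)"
      using generated_semigroup.comp arcs_comp(1,4) hom circle_Hom_preserves_or_reverses_arcs by blast+
    then show "{g \<in> generated_semigroup F. preserves_arcs g} \<noteq> {}"
      by blast
    fix x assume "x \<in> K"
    then have "K = orbit_closure (generated_semigroup F) x"
      using invariant_minimal_orbit_closure[OF F K] by simp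
    also have "\<dots> \<subseteq> orbit_closure {g \<in> generated_semigroup F. preserves_arcs g} x \<union>
        orbit_closure {g \<in> generated_semigroup F. reverses_arcs g} x"
      unfolding orbit_closure_def closure_Un[symmetric] using split by (intro closure_mono) blast
    finally show "K \<subseteq> \<dots>" .
  next
    fix f g
    assume "f \<in> {g \<in> generated_semigroup F. preserves_arcs g}"
      "g \<in> {g \<in> generated_semigroup F. preserves_arcs g}"
    then show "f \<circ> g \<in> {g \<in> generated_semigroup F. preserves_arcs g}"
      using arcs_comp(1)[OF hom] generated_semigroup.comp by blast
  next
    fix f g
    assume "f \<in> {g \<in> generated_semigroup F. preserves_arcs g}"
      "g \<in> {g \<in> generated_semigroup F. reverses_arcs g}"
    then show "f \<circ> g \<in> {g \<in> generated_semigroup F. reverses_arcs g}"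
      using arcs_comp(2)[OF hom] generated_semigroup.comp by blast
  next
    fix f g
    assume "f \<in> {g \<in> generated_semigroup F. reverses_arcs g}"
      "g \<in> {g \<in> generated_semigroup F. preserves_arcs g}"
    then show "f \<circ> g \<in> {g \<in> generated_semigroup F. reverses_arcs g}"
      using arcs_comp(3)[OF hom] generated_semigroup.comp by blast
  next
    fix f g
    assume "f \<in> {g \<in> generated_semigroup F. reverses_arcs g}"
      "g \<in> {g \<in> generated_semigroup F. reverses_arcs g}"
    then show "f \<circ> g \<in> {g \<in> generated_semigroup F. preserves_arcs g}"
      using arcs_comp(4)[OF hom] generated_semigroup.comp by blast
  qed
qed

section \<open>Construction of the sets \<open>L i\<close>\<close>

theorem theorem1:
  fixes F :: "(complex \<Rightarrow> complex) set"
    and d :: nat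
    and K :: "nat \<Rightarrow> complex set"
  assumes "F \<subseteq> circle_Hom"
    and "no_finite_orbit F"
    and "bij_betw K {1..d} {M. invariant_minimal F M}"
    and "d \<ge> 2"
  shows "\<exists>L :: nat \<Rightarrow> complex set.
    (\<forall>i\<in>{1..d}.
       finite_union_of_intervals (K i) (L i) \<and>
       invariant_set F (L i) \<and> K i \<subseteq> L i \<and>
       (\<forall>I\<in>components (L i). acts_proximally F I)) \<and>
    (\<forall>i\<in>{1..d}. \<forall>j\<in>{1..d}. i \<noteq> j \<longrightarrow> L i \<inter> L j = {}) \<and>
    (F \<subseteq> circle_Hom_plus \<longrightarrow>
       (\<forall>i\<in>{1..d}. \<forall>j\<in>{1..d}. card (components (L i)) = card (components (L j))))"
proof -
  obtain f0 where f0: "f0 \<in> F"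
    using no_finite_orbit_nonempty[OF assms(2)] by blast
  define G where "G = generated_semigroup F"
  define S T where "S = {g \<in> G. preserves_arcs g}" and "T = {g \<in> G. reverses_arcs g}"
  define X where "X = (\<Union>i\<in>{1..d}. K i)"
  note hom = generated_semigroup_circle_Hom[OF assms(1), folded G_def]
  have G_split: "G = S \<union> T"
    using circle_Hom_preserves_or_reverses_arcs hom by (auto simp: S_def T_def)
  have K_min: "invariant_minimal F (K i)" if "i \<in> {1..d}" for i
    using assms(3) that unfolding bij_betw_def by blast
  have K_disj: "K i \<inter> K j = {}" if "i \<in> {1..d}" "j \<in> {1..d}" "i \<noteq> j" for i j
    using invariant_minimal_disjoint[OF K_min K_min, of i j] that
      inj_on_eq_iff[OF bij_betw_imp_inj_on[OF assms(3)]] by blast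
  have K_props: "closed (K i)" "invariant_set F (K i)" "K i \<subseteq> circle" "K i \<noteq> {}" if "i \<in> {1..d}" for i
    using K_min[OF that] by (auto simp: invariant_minimal_def invariant_set_def)
  have KX: "K i \<subseteq> X" if "i \<in> {1..d}" for i
    using that by (auto simp: X_def)
  have graded: "graded_minimal S T (K i)" if "i \<in> {1..d}" for i
    using graded_minimal_semigroup[OF assms(1) f0 K_min[OF that]] by (simp add: S_def T_def G_def)
  have G_inv: "g x \<in> K i" if "g \<in> G" "i \<in> {1..d}" "x \<in> K i" for g i x
    using generated_semigroup_invariant[OF K_props(2)] that by (auto simp: G_def)
  \<comment> \<open>The colour of a point is its class, taken as a set. Colours from different
    minimal sets thus differ automatically, as nonempty subsets of disjoint sets.\<close>
  define c where "c = orbit_closure S"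
  have c_sub: "c x \<subseteq> K i" "x \<in> c x" if "i \<in> {1..d}" "x \<in> K i" for i x
    using graded_minimal.P_subset[OF graded] graded_minimal.P_refl[OF graded] that by (auto simp: c_def)
  have c_eq: "y \<in> K i" if "i \<in> {1..d}" "x \<in> K i" "c x = c y" "y \<in> X" for i x y
    using that c_sub unfolding X_def by blast
  have c_neq: "c x \<noteq> c y" if ij: "i \<in> {1..d}" "j \<in> {1..d}" "i \<noteq> j" and xy: "x \<in> K i" "y \<in> K j" for i j x y
  proof
    assume "c x = c y"
    then have "x \<in> K j"
      using c_sub(2)[OF ij(1) xy(1)] c_sub(1)[OF ij(2) xy(2)] by auto
    then show False
      using K_disj[OF ij] xy(1) by blast
  qed
  have class_eq: "{y \<in> X. c y = c x} = c x" if "i \<in> {1..d}" "x \<in> K i" for i x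
  proof (intro equalityI subsetI)
    fix y assume "y \<in> {y \<in> X. c y = c x}"
    then show "y \<in> c x"
      using c_sub unfolding X_def by blast
  next
    fix y assume y: "y \<in> c x"
    then have "y \<in> K i"
      using c_sub that by blast
    then show "y \<in> {y \<in> X. c y = c x}"
      using graded_minimal.P_eq_iff[OF graded[OF that(1)] that(2)] y KX[OF that(1)] by (auto simp: c_def)
  qed
  interpret coloured_set X c
  proof
    show "X \<subseteq> circle"
      unfolding X_def by (rule UN_least) (rule K_props(3))
    show "closed {x \<in> X. c x = v}" for v
    proof (cases "\<exists>x\<in>X. c x = v")
      case True
      then obtain i x where "i \<in> {1..d}" "x \<in> K i" "v = c x"
        by (auto simp: X_def)
      then show ?thesis
        using class_eq[of i x] by (simp add: c_def orbit_closure_def)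
    next
      case False
      then have "{x \<in> X. c x = v} = {}"
        by blast
      then show ?thesis
        by (metis closed_empty)
    qed
    have "c ` X = (\<Union>i\<in>{1..d}. c ` K i)"
      by (auto simp: X_def)
    then show "finite (c ` X)"
      using graded_minimal.finite_classes[OF graded] by (simp add: c_def)
    fix v
    \<comment> \<open>Points of two different minimal sets have different colours, so at least one
      of them avoids any prescribed colour \<open>v\<close>.\<close>
    have one: "1 \<in> {1..d}" and two: "2 \<in> {1..d}"
      using assms(4) by auto
    obtain p q where pq: "p \<in> K 1" "q \<in> K 2"
      using K_props(4)[OF one] K_props(4)[OF two] by blast
    have "c p \<noteq> c q"
      using c_neq[OF one two _ pq] by simp
    then show "\<exists>p\<in>X. c p \<noteq> v"
      using subsetD[OF KX[OF one] pq(1)] subsetD[OF KX[OF two] pq(2)] by metis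
  qed
  have resp: "respects_colour g" if g: "g \<in> G" for g
    unfolding respects_colour_def
  proof (intro conjI ballI)
    show "g \<in> circle_Hom"
      using hom g by blast
    show "g ` X \<subseteq> X"
      using G_inv[OF g] by (auto simp: X_def)
    fix x y assume "x \<in> X" "y \<in> X"
    then obtain i j where ij: "i \<in> {1..d}" "x \<in> K i" "j \<in> {1..d}" "y \<in> K j"
      by (auto simp: X_def)
    show "c (g x) = c (g y) \<longleftrightarrow> c x = c y"
    proof (cases "i = j")
      case True
      then show ?thesis
        using graded_minimal.P_image_eq_iff[OF graded[OF ij(1)]] ij g G_split by (simp add: c_def)
    next
      case False
      then have "c (g x) \<noteq> c (g y)" "c x \<noteq> c y"
        using c_neq[OF ij(1,3) False] ij G_inv[OF g] by blast+
      then show ?thesis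
        by simp
    qed
  qed
  have FG: "F \<subseteq> G"
    unfolding G_def by (blast intro: generated_semigroup.generator)
  define L where "L i = \<Union>(block_hull ` block ` K i)" for i
  have bX: "block ` K i \<subseteq> block ` X" if "i \<in> {1..d}" for i
    using KX[OF that] by blast
  \<comment> \<open>Linked points share a colour, hence a minimal set; in particular the ends of a
    hull lie in the minimal set of its block.\<close>
  have B_sub: "B \<subseteq> K i" if "i \<in> {1..d}" "B \<in> block ` K i" for i B
    using c_eq[OF that(1)] linked_colour linked_in that(2) unfolding block_def by blast
  have L_union: "finite_union_of_intervals (K i) (L i)" if i: "i \<in> {1..d}" for i
    unfolding finite_union_of_intervals_def
  proof (intro exI conjI)
    show "finite (hull_ends ` block ` K i)"
      using finite_subset[OF bX[OF i] finite_blocks] by simp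
    show "hull_ends ` block ` K i \<subseteq> K i \<times> K i"
    proof
      fix ab assume "ab \<in> hull_ends ` block ` K i"
      then obtain B where "B \<in> block ` K i" "ab = hull_ends B"
        by blast
      then show "ab \<in> K i \<times> K i"
        using hull_ends_in[of B] bX[OF i] B_sub[OF i] by (metis mem_Times_iff subsetD)
    qed
    show "L i = (\<Union>(a, b)\<in>hull_ends ` block ` K i. circle_interval a b)"
      by (auto simp: L_def block_hull_def case_prod_unfold)
  qed
  have K_L: "K i \<subseteq> L i" if i: "i \<in> {1..d}" for i
  proof
    fix x assume x: "x \<in> K i"
    then have "x \<in> block x" "block x \<in> block ` X"
      using KX[OF i] self_in_block by blast+
    then show "x \<in> L i"
      using hull_props(4) x unfolding L_def by blast
  qed
  have L_inv: "invariant_set F (L i)" if i: "i \<in> {1..d}" for i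
    unfolding invariant_set_def
  proof (intro conjI ballI)
    show "L i \<noteq> {}"
      using K_L[OF i] K_props(4)[OF i] by blast
    show "L i \<subseteq> circle"
      using hull_props(3) bX[OF i] unfolding L_def by blast
    fix f assume "f \<in> F"
    then have f: "f \<in> G"
      using FG by blast
    show "f ` L i \<subseteq> L i"
    proof
      fix w assume "w \<in> f ` L i"
      then obtain B where B: "B \<in> block ` K i" "w \<in> f ` block_hull B"
        unfolding L_def by blast
      then have BX: "B \<in> block ` X"
        using bX[OF i] by blast
      have "w \<in> block_hull (block (f (fst (hull_ends B))))"
        using image_hull_subset[OF resp[OF f] BX hull_ends_in(1,2)[OF BX]] B(2)
        by (auto simp: block_hull_def)
      moreover have "f (fst (hull_ends B)) \<in> K i"
        using G_inv[OF f i] B_sub[OF i B(1)] hull_ends_in(1)[OF BX] by blast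
      ultimately show "w \<in> L i"
        unfolding L_def by blast
    qed
  qed
  have L_prox: "acts_proximally F I" if i: "i \<in> {1..d}" and I: "I \<in> components (L i)" for i I
  proof -
    have "I \<in> block_hull ` block ` K i"
      using I components_Union_hulls(1)[OF bX[OF i]] by (simp add: L_def)
    then obtain B where B: "B \<in> block ` K i" "I = block_hull B"
      by blast
    then have BX: "B \<in> block ` X"
      using bX[OF i] by blast
    have ends: "fst (hull_ends B) \<in> B" "snd (hull_ends B) \<in> B"
      using hull_ends_in[OF BX] by auto
    then have "linked (fst (hull_ends B)) (snd (hull_ends B))"
      using block_cases[OF BX] by (auto simp: block_def)
    \<comment> \<open>Linked ends have the same class, so the first end lies in the closure of the
      positive orbit of the second: exactly what contraction asks for.\<close>
    then have "fst (hull_ends B) \<in> c (snd (hull_ends B))"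
      using linked_colour c_sub(2)[OF i, of "fst (hull_ends B)"] B_sub[OF i B(1)] ends(1) by auto
    then have close: "fst (hull_ends B) \<in> closure {g (snd (hull_ends B)) |g. g \<in> S}"
      by (simp add: c_def orbit_closure_def)
    show ?thesis
    proof (rule acts_proximallyI)
      fix \<epsilon> :: real assume "\<epsilon> > 0"
      then have "\<exists>g\<in>S. \<forall>x\<in>I. dist (g x) (fst (hull_ends B)) < \<epsilon>"
        using hull_contracts[OF BX _ close] resp B(2) by (simp add: S_def)
      then show "\<exists>g\<in>generated_semigroup F. \<forall>x\<in>I. dist (g x) (fst (hull_ends B)) < \<epsilon>"
        by (auto simp: S_def G_def)
    qed
  qed
  have L_disj: "L i \<inter> L j = {}" if ij: "i \<in> {1..d}" "j \<in> {1..d}" "i \<noteq> j" for i j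
  proof -
    have "block_hull B \<inter> block_hull B' = {}" if B: "B \<in> block ` K i" "B' \<in> block ` K j" for B B'
    proof (rule hull_disjoint)
      show BX: "B \<in> block ` X" "B' \<in> block ` X"
        using B bX ij by blast+
      show "B \<noteq> B'"
        using B_sub[OF ij(1) B(1)] B_sub[OF ij(2) B(2)] K_disj[OF ij] hull_props(5)[OF BX(1)] by blast
    qed
    then show ?thesis
      unfolding L_def by blast
  qed
  have L_card: "card (components (L i)) = card (components (L j))"
    if plus: "F \<subseteq> circle_Hom_plus" and ij: "i \<in> {1..d}" "j \<in> {1..d}" for i j
  proof -
    \<comment> \<open>Without negative elements each minimal set is a single class, so colours and
      minimal sets coincide and every element of \<open>G\<close> fixes all colours.\<close>
    have "S = G"
      using generated_semigroup_preserves_arcs[OF plus] by (auto simp: S_def G_def)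
    then have c_K: "c x = K i" if "i \<in> {1..d}" "x \<in> K i" for i x
      using invariant_minimal_orbit_closure[OF assms(1) f0 K_min[OF that(1)] that(2)]
      by (simp add: c_def G_def)
    have card_comp: "card (components (L i)) = card (block ` K i)" if "i \<in> {1..d}" for i
      using components_Union_hulls[OF bX[OF that]] by (simp add: L_def)
    have le: "card (block ` K i) \<le> card (block ` K j)" if ij: "i \<in> {1..d}" "j \<in> {1..d}" "i \<noteq> j" for i j
    proof -
      obtain x y where xy: "x \<in> K i" "y \<in> K j"
        using K_props(4) ij by blast
      have "card (block ` {z \<in> X. c z = c x}) \<le> card (block ` {z \<in> X. c z = c y})"
      proof (rule card_blocks_le)
        show "respects_colour g \<and> preserves_arcs g" if "g \<in> G" for g
          using resp[OF that] that \<open>S = G\<close> S_def by blast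
        show "c (g z) = c z" if "g \<in> G" "z \<in> X" for g z
          using that c_K G_inv unfolding X_def by blast
        show "\<exists>g\<in>G. linked w (g z)" if zw: "z \<in> X" "w \<in> X" "c z = c w" for z w
        proof -
          \<comment> \<open>Minimality only provides orbit points arbitrarily close to
            \<open>w\<close>; since blocks are relatively open, a close enough one already lies in
            the block of \<open>w\<close>.\<close>
          obtain e where e: "e > 0" "\<And>u. u \<in> X \<Longrightarrow> dist w u < e \<Longrightarrow> linked w u"
            using linked_near[OF zw(2)] by blast
          have "w \<in> c z"
            using zw(2,3) c_sub(2) unfolding X_def by auto
          then obtain g where "g \<in> G" "dist (g z) w < e"
            using e(1) \<open>S = G\<close> unfolding c_def orbit_closure_def closure_approachable by blast
          moreover have "g z \<in> X"
            using respects_colour_in[OF resp] \<open>g \<in> G\<close> zw(1) by blast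
          ultimately show ?thesis
            using e(2) by (metis dist_commute)
        qed
        show "x \<in> X" "y \<in> X"
          using xy KX ij by blast+
        show "c x \<noteq> c y"
          by (rule c_neq[OF ij xy])
      qed
      then show ?thesis
        using class_eq[OF ij(1) xy(1)] class_eq[OF ij(2) xy(2)] c_K xy ij by simp
    qed
    show ?thesis
      using le[OF ij] le[OF ij(2,1)] card_comp ij by (cases "i = j") auto
  qed
  show ?thesis
    by (intro exI[of _ L] conjI ballI impI)
      (assumption | rule L_union L_inv K_L L_prox L_disj L_card)+
qed

end
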